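(* Let $\{x(t)\}_{t\ge 1}$ be the iterates of the stochastic mirror descent algorithm $$x(t+1)=\operatorname*{arg\,min}_{x\in\mathbb{X}}\Big\{\langle \tilde g(t),x-x(t)\rangle+\frac{1}{\alpha(t)}\mathbb{D}_R(x,x(t))\Big\},\qquad t\ge 1,$$ for the problem $\min_{x\in\mathbb{X}}f(x)$, where the step-sizes and the stochastic subgradients satisfy Assumptions A1, A2, A3 of the context. Then $\{x(t)\}$ converges almost surely to a point of $\mathbb{X}^\ast$; that is, there is a random vector $x^\ast$ with values in $\mathbb{X}^\ast$ such that $x(t)\to x^\ast$ almost surely.
   Context: Setting. $\|\cdot\|$ is an arbitrary norm on $\mathbb{R}^n$, $\|x\|_\ast=\sup\{\langle x,y\rangle:\|y\|\le 1\}$ its dual norm. $\mathbb{X}\subseteq\mathbb{R}^n$ is nonempty, convex and compact. $f:\mathbb{R}^n\to\mathbb{R}$ is convex (and continuous), $f^\ast=\min_{x\in\mathbb{X}}f(x)$, $\mathbb{X}^\ast=\{x\in\mathbb{X}: f(x)=f^\ast\}$ (nonempty). Bregman divergence. $R$ is $\sigma_R$-strongly convex with respect to $\|\cdot\|$ ($\sigma_R>0$) and differentiable on an open set containing $\mathbb{X}$, and $\mathbb{D}_R(x,y)=R(x)-R(y)-\langle\nabla R(y),x-y\rangle$ for $x,y\in\mathbb{X}$. Algorithm. $x(1)\in\mathbb{X}$ is the initial point, $\alpha(t)>0$ are deterministic step-sizes, and $\tilde g(t)$ is a random vector (a noisy subgradient of $f$ at $x(t)$). $\mathcal{F}_t=\sigma(x(1),\dots,x(t))$.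 Assumption A1. $\mathbb{E}[\tilde g(t)\mid\mathcal{F}_t]=g(t)+b(t)$ a.s., where $g(t)\in\partial f(x(t))$ is a subgradient of $f$ at $x(t)$ and $b(t)$ is an $\mathcal{F}_t$-measurable random vector (the bias); and $\mathbb{E}[\|\tilde g(t)\|_\ast^2\mid\mathcal{F}_t]\le\nu^2$ a.s. for all $t$, for a constant $\nu$. Assumption A2. $\sum_{t\ge1}\alpha(t)=\infty$ and $\sum_{t\ge1}\alpha(t)^2<\infty$. Assumption A3. With $B(t)=\|b(t)\|_\ast$, $\sum_{t\ge1}\alpha(t)B(t)<\infty$ almost surely. *)

theory Defs
  imports "HOL-Probability.Probability"
begin

definition is_norm :: "('a::real_vector \<Rightarrow> real) \<Rightarrow> bool" where
  "is_norm N \<longleftrightarrow>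
     (\<forall>x. 0 \<le> N x) \<and> (\<forall>x. N x = 0 \<longleftrightarrow> x = 0) \<and>
     (\<forall>c x. N (c *\<^sub>R x) = \<bar>c\<bar> * N x) \<and> (\<forall>x y. N (x + y) \<le> N x + N y)"

definition dual_norm :: "('a::real_inner \<Rightarrow> real) \<Rightarrow> 'a \<Rightarrow> real" where
  "dual_norm N x = (SUP y\<in>{y. N y \<le> 1}. x \<bullet> y)"

definition strongly_convex_on ::
  "'a::real_vector set \<Rightarrow> ('a \<Rightarrow> real) \<Rightarrow> real \<Rightarrow> ('a \<Rightarrow> real) \<Rightarrow> bool" where
  "strongly_convex_on U N \<sigma> R \<longleftrightarrow>
     convex U \<and>
     (\<forall>x\<in>U. \<forall>y\<in>U. \<forall>u\<in>{0..1}.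
        R ((1 - u) *\<^sub>R x + u *\<^sub>R y)
          \<le> (1 - u) * R x + u * R y - \<sigma> / 2 * u * (1 - u) * (N (x - y))\<^sup>2)"

definition gradient :: "('a::real_inner \<Rightarrow> real) \<Rightarrow> 'a \<Rightarrow> 'a" where
  "gradient F x = (THE D. GDERIV F x :> D)"

lemma GDERIV_gradient:
  fixes F :: "'a::euclidean_space \<Rightarrow> real"
  assumes "F differentiable (at x)"
  shows "GDERIV F x :> gradient F x"
proof -
  obtain F' where F': "(F has_derivative F') (at x)"
    using assms unfolding differentiable_def by blast
  have "bounded_linear F'"
    using F' by (rule has_derivative_bounded_linear)
  then have lin: "linear F'"
    by (rule bounded_linear.linear)
  define D where "D = adjoint F' 1"
  have "F' h = h \<bullet> D" for h
    unfolding D_def adjoint_works[OF lin] by simp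
  then have F'_eq: "F' = (\<lambda>h. h \<bullet> D)"
    by (rule ext)
  have D: "GDERIV F x :> D"
    using F' unfolding gderiv_def F'_eq .
  moreover have "E = D" if "GDERIV F x :> E" for E
  proof -
    have "(\<lambda>h. h \<bullet> E) = (\<lambda>h. h \<bullet> D)"
      using that D unfolding gderiv_def by (rule has_derivative_unique)
    then have "\<forall>h. h \<bullet> E = h \<bullet> D"
      unfolding fun_eq_iff .
    then show ?thesis
      by (rule iffD1[OF vector_eq_ldot])
  qed
  ultimately show ?thesis
    unfolding gradient_def by (rule theI)
qed

definition bregman :: "('a::real_inner \<Rightarrow> real) \<Rightarrow> 'a \<Rightarrow> 'a \<Rightarrow> real" where
  "bregman R x y = R x - R y - gradient R y \<bullet> (x - y)"

definition subdifferential :: "('a::real_inner \<Rightarrow> real) \<Rightarrow> 'a \<Rightarrow> 'a set" where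
  "subdifferential f x = {g. \<forall>y. f y \<ge> f x + g \<bullet> (y - x)}"

definition opt_val :: "('a \<Rightarrow> real) \<Rightarrow> 'a set \<Rightarrow> real" where
  "opt_val f X = (INF x\<in>X. f x)"

definition opt_set :: "('a \<Rightarrow> real) \<Rightarrow> 'a set \<Rightarrow> 'a set" where
  "opt_set f X = {x \<in> X. f x = opt_val f X}"

definition hist :: "'w measure \<Rightarrow> (nat \<Rightarrow> 'w \<Rightarrow> 'b::topological_space) \<Rightarrow> nat \<Rightarrow> 'w measure" where
  "hist M x t = sigma (space M) (\<Union>i\<in>{1..t}. {x i -` A \<inter> space M | A. A \<in> sets borel})"

definition vec_cond_exp ::
  "'w measure \<Rightarrow> 'w measure \<Rightarrow> ('w \<Rightarrow> real ^ 'n) \<Rightarrow> 'w \<Rightarrow> real ^ 'n" where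
  "vec_cond_exp M F Y \<omega> = (\<chi> i. real_cond_exp M F (\<lambda>\<omega>'. Y \<omega>' $ i) \<omega>)"

text \<open>
  The conditional second moment is the extended nonnegative \<^const>\<open>nn_cond_exp\<close>, since
  \<^const>\<open>real_cond_exp\<close> is not meaningful for non-integrable functions (an infinite value is
  mapped to 0). The bound on the second moment makes every component of the noisy subgradient
  integrable, so that \<^const>\<open>vec_cond_exp\<close> is a genuine conditional expectation there.
\<close>

definition assumption_A1 ::
  "'w measure \<Rightarrow> (real ^ 'n \<Rightarrow> real) \<Rightarrow> (real ^ 'n \<Rightarrow> real) \<Rightarrow> (nat \<Rightarrow> 'w \<Rightarrow> real ^ 'n) \<Rightarrow>
   (nat \<Rightarrow> 'w \<Rightarrow> real ^ 'n) \<Rightarrow> (nat \<Rightarrow> 'w \<Rightarrow> real ^ 'n) \<Rightarrow> (nat \<Rightarrow> 'w \<Rightarrow> real ^ 'n) \<Rightarrow> real \<Rightarrow> bool" where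
  "assumption_A1 M N f x gn g b \<nu> \<longleftrightarrow>
     (\<forall>t\<ge>1.
        (AE \<omega> in M. g t \<omega> \<in> subdifferential f (x t \<omega>)) \<and>
        b t \<in> borel_measurable (hist M x t) \<and>
        (AE \<omega> in M. vec_cond_exp M (hist M x t) (gn t) \<omega> = g t \<omega> + b t \<omega>) \<and>
        (AE \<omega> in M. nn_cond_exp M (hist M x t) (\<lambda>\<omega>'. ennreal ((dual_norm N (gn t \<omega>'))\<^sup>2)) \<omega>
                     \<le> ennreal (\<nu>\<^sup>2)))"

definition assumption_A2 :: "(nat \<Rightarrow> real) \<Rightarrow> bool" where
  "assumption_A2 \<alpha> \<longleftrightarrow>
     filterlim (\<lambda>n. \<Sum>t=1..n. \<alpha> t) at_top sequentially \<and>
     summable (\<lambda>t. (\<alpha> (Suc t))\<^sup>2)"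

definition assumption_A3 ::
  "'w measure \<Rightarrow> ('a::real_inner \<Rightarrow> real) \<Rightarrow> (nat \<Rightarrow> real) \<Rightarrow> (nat \<Rightarrow> 'w \<Rightarrow> 'a) \<Rightarrow> bool" where
  "assumption_A3 M N \<alpha> b \<longleftrightarrow>
     (AE \<omega> in M. summable (\<lambda>t. \<alpha> (Suc t) * dual_norm N (b (Suc t) \<omega>)))"

end

theory Submission
  imports Defs
begin

text \<open>
  Fix a minimizer z and watch the Bregman distance from z to the iterate x(t). One mirror step
  gives, pathwise (mirror_step_bregman),

    D(z, x(t+1)) \<le> D(z, x(t)) + \<alpha>(t) <gn(t), z - x(t)> + \<alpha>(t)^2 |gn(t)|^2 / (2 s),

  where s is the modulus of strong convexity of R for the Euclidean norm; all norms on the space are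
  equivalent, so the given norm and its dual enter only through constants. Conditioning on the past
  turns gn(t) into a subgradient plus the bias, hence

    E[D(z, x(t+1)) | F_t] \<le> D(z, x(t)) - \<alpha>(t) (f(x(t)) - f*) + e(t)

  with error terms e(t) \<ge> 0 that are known at time t and almost surely summable. This is an
  almost-supermartingale, and the Robbins-Siegmund theorem (bounded_robbins_siegmund) yields, almost
  surely, that D(z, x(t)) converges and that the sum of \<alpha>(t) (f(x(t)) - f*) is finite.

  Since the step sizes are not summable, f(x(t)) comes arbitrarily close to f*, and by compactness
  some subsequence of x(t) tends to a random minimizer p (optimal_cluster_point). It remains to see
  that D(p, x(t)) tends to 0. The exceptional null set above depends on z, and p is random, so z is
  taken from a countable dense set of minimizers; as D(z, y) is Lipschitz in z uniformly in y,
  convergence for those z is enough (bregman_convergence). Strong convexity then turns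
  D(p, x(t)) \<longlonglongrightarrow> 0 into x(t) \<longlonglongrightarrow> p.

  A tempting shortcut would be to sum the noise gn(t) - E[gn(t) | F_t] as an L2 martingale. That
  sum is in general no martingale: F_t is generated by the iterates alone, and the mirror step may
  forget part of gn(t) at the boundary of X, so that past noise need not be known at time t. The argument
  therefore applies the Doob decomposition to the process D(z, x(t)) itself, which is adapted. Its
  martingale part is controlled by the boundedness of the Bregman distance on the compact set X and
  converges by Kolmogorov's maximal inequality.
\<close>

section \<open>Square-summable series of martingale differences\<close>

lemma (in prob_space) integrable_bounded_real:
  fixes f :: "'a \<Rightarrow> real"
  assumes "f \<in> borel_measurable M" "\<And>\<omega>. \<omega> \<in> space M \<Longrightarrow> \<bar>f \<omega>\<bar> \<le> K"
  shows "integrable M f"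
  using assms by (intro integrable_const_bound[where B = K]) (auto intro!: AE_I2)

lemma filtration_measurable:
  assumes "\<And>n. subalgebra (F (Suc n)) (F n)" "m \<le> n" "f \<in> borel_measurable (F m)"
  shows "f \<in> borel_measurable (F (n::nat))"
  using assms(2,3)
proof (induction n rule: dec_induct)
  case (step n)
  then show ?case using measurable_from_subalg[OF assms(1)[of n]] by blast
qed simp

text \<open>
  The condition E[d n | F n] = 0 is stated as orthogonality of d n to all bounded F n-measurable
  functions. This is the form in which both the orthogonality of increments and the stability under
  stopping (multiplication by predictable indicators) are immediate.
\<close>

locale bounded_martingale_differences = prob_space M
  for M :: "'w measure" and F :: "nat \<Rightarrow> 'w measure" and d :: "nat \<Rightarrow> 'w \<Rightarrow> real" and C :: real +
  assumes sub: "\<And>n. subalgebra M (F n)" and mono: "\<And>n. subalgebra (F (Suc n)) (F n)"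
    and meas: "\<And>n. d n \<in> borel_measurable (F (Suc n))"
    and bound: "\<And>n \<omega>. \<omega> \<in> space M \<Longrightarrow> \<bar>d n \<omega>\<bar> \<le> C"
    and orth: "\<And>n W K. W \<in> borel_measurable (F n) \<Longrightarrow>
      (\<And>\<omega>. \<omega> \<in> space M \<Longrightarrow> \<bar>W \<omega>\<bar> \<le> K) \<Longrightarrow> expectation (\<lambda>\<omega>. W \<omega> * d n \<omega>) = 0"
begin

text \<open>
  A predictable switch J keeps increments orthogonal, so the second moment of the stopped sum is the
  sum of the second moments of the increments that are kept. Stopping times are thereby avoided.
\<close>

lemma martingale_difference_sum_square:
  assumes J: "\<And>n. J n \<in> borel_measurable (F n)" "\<And>n \<omega>. J n \<omega> \<in> {0, 1}"
    and "m \<le> n"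
  shows "expectation (\<lambda>\<omega>. (\<Sum>t=m..<n. J t \<omega> * d t \<omega>)\<^sup>2) \<le> (\<Sum>t=m..<n. expectation (\<lambda>\<omega>. (d t \<omega>)\<^sup>2))"
  using \<open>m \<le> n\<close>
proof (induction n rule: dec_induct)
  case (step n)
  define Z where "Z = (\<lambda>\<omega>. \<Sum>t=m..<n. J t \<omega> * d t \<omega>)"
  note FM = measurable_from_subalg[OF sub]
  have [measurable]: "d k \<in> borel_measurable M" "J k \<in> borel_measurable M" for k
    using FM meas J(1) by blast+
  have [measurable]: "Z \<in> borel_measurable M" unfolding Z_def by measurable
  have Jd: "\<bar>J k \<omega> * d k \<omega>\<bar> \<le> C" if "\<omega> \<in> space M" for k \<omega>
    using bound[OF that, of k] J(2)[of k \<omega>] by auto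
  have C0: "0 \<le> C" using not_empty bound by (metis abs_ge_zero ex_in_conv order_trans)
  have Zb: "\<bar>Z \<omega>\<bar> \<le> real (n - m) * C" if "\<omega> \<in> space M" for \<omega>
  proof -
    have "\<bar>Z \<omega>\<bar> \<le> (\<Sum>t=m..<n. \<bar>J t \<omega> * d t \<omega>\<bar>)" unfolding Z_def by (rule sum_abs)
    also have "\<dots> \<le> (\<Sum>t=m..<n. C)" by (intro sum_mono Jd that)
    finally show ?thesis by simp
  qed
  have ZF: "Z \<in> borel_measurable (F n)"
    unfolding Z_def
  proof (intro borel_measurable_sum borel_measurable_times)
    fix t assume "t \<in> {m..<n}"
    then show "J t \<in> borel_measurable (F n)" "d t \<in> borel_measurable (F n)"
      using filtration_measurable[where F = F, OF mono _ J(1), of t n]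
        filtration_measurable[where F = F, OF mono _ meas, of t n] by auto
  qed
  have W: "(\<lambda>\<omega>. 2 * (Z \<omega> * J n \<omega>)) \<in> borel_measurable (F n)"
    using ZF J(1)[of n] by measurable
  have Wb: "\<bar>2 * (Z \<omega> * J n \<omega>)\<bar> \<le> 2 * (real (n - m) * C)" if "\<omega> \<in> space M" for \<omega>
    using Zb[OF that] J(2)[of n \<omega>] C0 by (auto simp: abs_mult)
  have cross: "expectation (\<lambda>\<omega>. 2 * (Z \<omega> * J n \<omega>) * d n \<omega>) = 0"
    by (rule orth[OF W Wb])
  have I1: "integrable M (\<lambda>\<omega>. (Z \<omega>)\<^sup>2)"
    by (rule integrable_bounded_real[where K = "(real (n - m) * C)\<^sup>2"])
       (measurable, use Zb abs_le_square_iff[of "Z _" "real (n - m) * C"] C0 in auto)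
  have I2: "integrable M (\<lambda>\<omega>. (J n \<omega> * d n \<omega>)\<^sup>2)"
    by (rule integrable_bounded_real[where K = "C\<^sup>2"])
       (measurable, use Jd abs_le_square_iff[of _ "C"] C0 in auto)
  have I4: "integrable M (\<lambda>\<omega>. (d n \<omega>)\<^sup>2)"
    by (rule integrable_bounded_real[where K = "C\<^sup>2"])
       (measurable, use bound abs_le_square_iff[of _ "C"] C0 in auto)
  have I3: "integrable M (\<lambda>\<omega>. 2 * (Z \<omega> * J n \<omega>) * d n \<omega>)"
  proof (rule integrable_bounded_real[where K = "2 * (real (n - m) * C) * C"])
    fix \<omega> assume "\<omega> \<in> space M"
    then show "\<bar>2 * (Z \<omega> * J n \<omega>) * d n \<omega>\<bar> \<le> 2 * (real (n - m) * C) * C"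
      using mult_mono[OF Wb bound] C0 by (simp add: abs_mult)
  qed measurable
  have "expectation (\<lambda>\<omega>. (\<Sum>t=m..<Suc n. J t \<omega> * d t \<omega>)\<^sup>2)
      = expectation (\<lambda>\<omega>. (Z \<omega>)\<^sup>2 + 2 * (Z \<omega> * J n \<omega>) * d n \<omega> + (J n \<omega> * d n \<omega>)\<^sup>2)"
    using \<open>m \<le> n\<close> by (simp add: Z_def power2_eq_square algebra_simps)
  also have "\<dots> = expectation (\<lambda>\<omega>. (Z \<omega>)\<^sup>2) + expectation (\<lambda>\<omega>. (J n \<omega> * d n \<omega>)\<^sup>2)"
    using I1 I2 I3 cross by simp
  also have "expectation (\<lambda>\<omega>. (J n \<omega> * d n \<omega>)\<^sup>2) \<le> expectation (\<lambda>\<omega>. (d n \<omega>)\<^sup>2)"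
  proof (rule integral_mono[OF I2 I4])
    fix \<omega> show "(J n \<omega> * d n \<omega>)\<^sup>2 \<le> (d n \<omega>)\<^sup>2" using J(2)[of n \<omega>] by auto
  qed
  finally show ?case using step unfolding Z_def by simp
qed simp

text \<open>
  The sum is frozen as soon as its modulus reaches \<epsilon>. On the event in question the frozen
  sum still has modulus at least \<epsilon> at time n, so Chebyshev's inequality for that single random variable
  bounds the probability of the maximum.
\<close>

lemma kolmogorov_maximal_inequality:
  assumes "m \<le> n" "0 < \<epsilon>"
  shows "\<epsilon>\<^sup>2 * prob {\<omega> \<in> space M. \<exists>k\<in>{m..n}. \<epsilon> \<le> \<bar>\<Sum>t=m..<k. d t \<omega>\<bar>}
      \<le> (\<Sum>t=m..<n. expectation (\<lambda>\<omega>. (d t \<omega>)\<^sup>2))"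
proof -
  \<comment> \<open>J t = 1 as long as no partial sum up to time t has left the \<epsilon>-ball; it is known at time t.\<close>
  define small where "small = (\<lambda>t \<omega>. \<forall>k\<in>{m..t}. \<bar>\<Sum>t=m..<k. d t \<omega>\<bar> < \<epsilon>)"
  define J where "J = (\<lambda>t \<omega>. if small t \<omega> then 1 else 0 :: real)"
  define Z where "Z = (\<lambda>\<omega>. \<Sum>t=m..<n. J t \<omega> * d t \<omega>)"
  define A where "A = {\<omega> \<in> space M. \<exists>k\<in>{m..n}. \<epsilon> \<le> \<bar>\<Sum>t=m..<k. d t \<omega>\<bar>}"
  note FM = measurable_from_subalg[OF sub]
  have dF: "d k \<in> borel_measurable (F t)" if "k < t" for k t
    using filtration_measurable[where F = F, OF mono _ meas, of k t] that by auto
  have [measurable]: "d k \<in> borel_measurable M" for k using FM meas by blast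
  have JF: "J t \<in> borel_measurable (F t)" for t
  proof -
    have 1: "(\<lambda>\<omega>. \<Sum>t=m..<k. d t \<omega>) \<in> borel_measurable (F t)" if "k \<in> {m..t}" for k
      using that by (intro borel_measurable_sum dF) auto
    have "Measurable.pred (F t) (small t)"
      unfolding small_def by (intro pred_intros_finite borel_measurable_pred_less borel_measurable_abs 1) auto
    then show ?thesis unfolding J_def by measurable
  qed
  have [measurable]: "J k \<in> borel_measurable M" for k using FM JF by blast
  have [measurable]: "A \<in> sets M" unfolding A_def by measurable
  have C0: "0 \<le> C" using not_empty bound by (metis abs_ge_zero ex_in_conv order_trans)
  have Zge: "\<epsilon> \<le> \<bar>Z \<omega>\<bar>" if A: "\<omega> \<in> A" for \<omega>
  proof -
    define k where "k = (LEAST k. k \<in> {m..n} \<and> \<epsilon> \<le> \<bar>\<Sum>t=m..<k. d t \<omega>\<bar>)"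
    have k: "k \<in> {m..n} \<and> \<epsilon> \<le> \<bar>\<Sum>t=m..<k. d t \<omega>\<bar>"
      unfolding k_def by (rule LeastI_ex) (use A in \<open>auto simp: A_def\<close>)
    have least: "\<not> (j \<in> {m..n} \<and> \<epsilon> \<le> \<bar>\<Sum>t=m..<j. d t \<omega>\<bar>)" if "j < k" for j
      using not_less_Least[of j] that unfolding k_def by blast
    have "Z \<omega> = (\<Sum>t=m..<k. J t \<omega> * d t \<omega>) + (\<Sum>t=k..<n. J t \<omega> * d t \<omega>)"
      unfolding Z_def using k by (simp add: sum.atLeastLessThan_concat)
    also have "(\<Sum>t=k..<n. J t \<omega> * d t \<omega>) = 0"
      using k by (intro sum.neutral) (force simp: J_def small_def not_less)
    also have "(\<Sum>t=m..<k. J t \<omega> * d t \<omega>) = (\<Sum>t=m..<k. d t \<omega>)"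
    proof (rule sum.cong)
      fix t assume "t \<in> {m..<k}"
      then have "small t \<omega>" unfolding small_def using least k
        by (metis atLeastAtMost_iff atLeastLessThan_iff less_imp_le_nat not_le order.strict_trans1 order_trans)
      then show "J t \<omega> * d t \<omega> = d t \<omega>" by (simp add: J_def)
    qed simp
    finally show ?thesis using k by simp
  qed
  have Zb: "\<bar>Z \<omega>\<bar> \<le> real (n - m) * C" if "\<omega> \<in> space M" for \<omega>
  proof -
    have "\<bar>Z \<omega>\<bar> \<le> (\<Sum>t=m..<n. \<bar>J t \<omega> * d t \<omega>\<bar>)" unfolding Z_def by (rule sum_abs)
    also have "\<dots> \<le> (\<Sum>t=m..<n. C)"
      using bound[OF that] C0 by (intro sum_mono) (auto simp: J_def)
    finally show ?thesis by simp
  qed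
  have [measurable]: "Z \<in> borel_measurable M" unfolding Z_def by measurable
  have I1: "integrable M (\<lambda>\<omega>. (Z \<omega>)\<^sup>2)"
    by (rule integrable_bounded_real[where K = "(real (n - m) * C)\<^sup>2"])
       (measurable, use Zb abs_le_square_iff[of "Z _" "real (n - m) * C"] C0 in auto)
  have "\<epsilon>\<^sup>2 * prob A = expectation (\<lambda>\<omega>. \<epsilon>\<^sup>2 * indicator A \<omega>)"
    by simp
  also have "\<dots> \<le> expectation (\<lambda>\<omega>. (Z \<omega>)\<^sup>2)"
  proof (rule integral_mono[OF _ I1])
    fix \<omega>
    show "\<epsilon>\<^sup>2 * indicator A \<omega> \<le> (Z \<omega>)\<^sup>2"
      using Zge[of \<omega>] \<open>0 < \<epsilon>\<close> abs_le_square_iff[of \<epsilon> "Z \<omega>"] by (auto simp: indicator_def)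
  qed (rule integrable_mult_right, simp add: integrable_indicator_iff emeasure_eq_measure)
  also have "\<dots> \<le> (\<Sum>t=m..<n. expectation (\<lambda>\<omega>. (d t \<omega>)\<^sup>2))"
    unfolding Z_def
    by (rule martingale_difference_sum_square)
       (use JF \<open>m \<le> n\<close> in \<open>auto simp: J_def\<close>)
  finally show ?thesis unfolding A_def .
qed

text \<open>
  The maximal inequality over all k \<ge> m bounds the probability of an \<epsilon>-oscillation after time m
  by the tail of a convergent series, so almost surely the partial sums are Cauchy.
\<close>

theorem martingale_difference_series_converges:
  assumes var: "summable (\<lambda>n. expectation (\<lambda>\<omega>. (d n \<omega>)\<^sup>2))"
  shows "AE \<omega> in M. summable (\<lambda>n. d n \<omega>)"
proof -
  define v where "v = (\<lambda>n. expectation (\<lambda>\<omega>. (d n \<omega>)\<^sup>2))"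
  have v0: "0 \<le> v n" for n unfolding v_def by simp
  have [measurable]: "d k \<in> borel_measurable M" for k
    using measurable_from_subalg[OF sub meas] .
  define A where "A = (\<lambda>\<epsilon> m. {\<omega> \<in> space M. \<exists>k\<ge>m. \<epsilon> \<le> \<bar>\<Sum>t=m..<k. d t \<omega>\<bar>})"
  have [measurable]: "A \<epsilon> m \<in> sets M" for \<epsilon> m unfolding A_def by measurable
  have PA: "\<epsilon>\<^sup>2 * prob (A \<epsilon> m) \<le> (\<Sum>n. v (n + m))" if "0 < \<epsilon>" for \<epsilon> m
  proof -
    define An where "An = (\<lambda>n. {\<omega> \<in> space M. \<exists>k\<in>{m..m+n}. \<epsilon> \<le> \<bar>\<Sum>t=m..<k. d t \<omega>\<bar>})"
    have "range An \<subseteq> sets M" unfolding An_def by auto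
    moreover have "incseq An" unfolding An_def incseq_def by force
    ultimately have "(\<lambda>n. prob (An n)) \<longlonglongrightarrow> prob (\<Union>n. An n)"
      by (rule finite_Lim_measure_incseq)
    also have "(\<Union>n. An n) = A \<epsilon> m"
    proof
      show "A \<epsilon> m \<subseteq> (\<Union>n. An n)"
      proof
        fix \<omega> assume "\<omega> \<in> A \<epsilon> m"
        then obtain k where "\<omega> \<in> space M" "m \<le> k" "\<epsilon> \<le> \<bar>\<Sum>t=m..<k. d t \<omega>\<bar>"
          unfolding A_def by blast
        then have "\<omega> \<in> An (k - m)" unfolding An_def by auto
        then show "\<omega> \<in> (\<Union>n. An n)" by blast
      qed
    qed (auto simp: An_def A_def)
    finally have "(\<lambda>n. \<epsilon>\<^sup>2 * prob (An n)) \<longlonglongrightarrow> \<epsilon>\<^sup>2 * prob (A \<epsilon> m)"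
      by (intro tendsto_intros)
    moreover have "\<epsilon>\<^sup>2 * prob (An n) \<le> (\<Sum>n. v (n + m))" for n
    proof -
      have "\<epsilon>\<^sup>2 * prob (An n) \<le> (\<Sum>t=m..<m+n. v t)"
        unfolding An_def v_def
        by (rule kolmogorov_maximal_inequality) (use that in auto)
      also have "\<dots> = (\<Sum>t<n. v (t + m))"
        using sum.shift_bounds_nat_ivl[of v 0 m n] by (simp add: atLeast0LessThan add.commute)
      also have "\<dots> \<le> (\<Sum>n. v (n + m))"
        using var[folded v_def] v0 by (intro sum_le_suminf summable_ignore_initial_segment) auto
      finally show ?thesis .
    qed
    ultimately show ?thesis by (intro LIMSEQ_le_const2) auto
  qed
  have small: "AE \<omega> in M. \<exists>m. \<forall>k\<ge>m. \<bar>\<Sum>t=m..<k. d t \<omega>\<bar> < \<epsilon>" if "0 < \<epsilon>" for \<epsilon>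
  proof (rule AE_I)
    show "{\<omega> \<in> space M. \<not> (\<exists>m. \<forall>k\<ge>m. \<bar>\<Sum>t=m..<k. d t \<omega>\<bar> < \<epsilon>)} \<subseteq> (\<Inter>m. A \<epsilon> m)"
      by (auto simp: A_def not_less)
    have "prob (\<Inter>m. A \<epsilon> m) \<le> 0"
    proof (rule LIMSEQ_le_const)
      show "(\<lambda>m. (\<Sum>n. v (n + m)) / \<epsilon>\<^sup>2) \<longlonglongrightarrow> 0"
        using suminf_exist_split2[OF var[folded v_def]] by (intro tendsto_divide_zero)
      have "prob (\<Inter>m. A \<epsilon> m) \<le> (\<Sum>n. v (n + m)) / \<epsilon>\<^sup>2" for m
      proof -
        have "prob (\<Inter>m. A \<epsilon> m) \<le> prob (A \<epsilon> m)" by (intro finite_measure_mono) auto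
        also have "\<dots> \<le> (\<Sum>n. v (n + m)) / \<epsilon>\<^sup>2"
          using PA[OF that, of m] that by (simp add: field_simps)
        finally show ?thesis .
      qed
      then show "\<exists>N. \<forall>m\<ge>N. prob (\<Inter>m. A \<epsilon> m) \<le> (\<Sum>n. v (n + m)) / \<epsilon>\<^sup>2" by blast
    qed
    then have "prob (\<Inter>m. A \<epsilon> m) = 0" using measure_nonneg[of M] by (simp add: antisym)
    then show "emeasure M (\<Inter>m. A \<epsilon> m) = 0" by (simp add: emeasure_eq_measure)
  qed measurable
  have "AE \<omega> in M. \<forall>j::nat. \<exists>m. \<forall>k\<ge>m. \<bar>\<Sum>t=m..<k. d t \<omega>\<bar> < 1 / Suc j"
    using small by (auto simp: AE_all_countable)
  then show ?thesis
  proof eventually_elim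
    case (elim \<omega>)
    show ?case unfolding summable_Cauchy
    proof (intro allI impI)
      fix e :: real assume "0 < e"
      then obtain j where j: "1 / real (Suc j) < e / 2"
        using reals_Archimedean[of "e / 2"] by (auto simp: inverse_eq_divide)
      obtain m where m: "\<And>k. k \<ge> m \<Longrightarrow> \<bar>\<Sum>t=m..<k. d t \<omega>\<bar> < 1 / real (Suc j)"
        using elim by blast
      have "norm (\<Sum>t=p..<q. d t \<omega>) < e" if "m \<le> p" for p q
      proof (cases "p \<le> q")
        case True
        then have "(\<Sum>t=m..<q. d t \<omega>) = (\<Sum>t=m..<p. d t \<omega>) + (\<Sum>t=p..<q. d t \<omega>)"
          using that by (simp add: sum.atLeastLessThan_concat)
        then show ?thesis using m[of p] m[of q] j that True by (simp add: abs_if split: if_splits)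
      next
        case False
        then show ?thesis using \<open>0 < e\<close> by simp
      qed
      then show "\<exists>N. \<forall>m\<ge>N. \<forall>n. norm (sum (\<lambda>n. d n \<omega>) {m..<n}) < e" by blast
    qed
  qed
qed

end

section \<open>The Robbins-Siegmund theorem for bounded processes\<close>

text \<open>
  Adding the sum of the u k and subtracting that of the w k makes the sequence decreasing and bounded
  below. The w k may have any sign and need to be only conditionally summable, because they are going
  to contain the martingale increments.
\<close>

lemma almost_decreasing_sequence:
  fixes a u w :: "nat \<Rightarrow> real"
  assumes a: "\<And>n. 0 \<le> a n" and u: "\<And>n. 0 \<le> u n" and w: "summable w"
    and step: "\<And>n. a (Suc n) \<le> a n - u n + w n"
  shows "convergent a" "summable u"
proof -
  define c where "c = (\<lambda>n. a n + (\<Sum>k<n. u k) - (\<Sum>k<n. w k))"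
  have W: "convergent (\<lambda>n. \<Sum>k<n. w k)" using w by (simp add: summable_iff_convergent)
  then obtain B where B: "\<And>n. \<bar>\<Sum>k<n. w k\<bar> \<le> B"
    using Bseq_def[of "\<lambda>n. \<Sum>k<n. w k"] convergent_imp_Bseq by auto
  have c_dec: "c (Suc n) \<le> c n" for n unfolding c_def using step[of n] by simp
  then have c_le: "c n \<le> c 0" for n by (rule lift_Suc_antimono_le) simp
  have c_ge: "- B \<le> c n" for n
    unfolding c_def using a[of n] B[of n] sum_nonneg[of "{..<n}" u] u by (auto simp: abs_le_iff)
  have "convergent c"
    using decseq_convergent[of c "- B"] c_ge c_dec by (metis convergentI decseq_SucI)
  show "summable u"
  proof (rule summableI_nonneg_bounded[OF u])
    show "(\<Sum>k<n. u k) \<le> c 0 + B" for n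
      using c_le[of n] a[of n] B[of n] unfolding c_def by (auto simp: abs_le_iff)
  qed
  then have "convergent (\<lambda>n. \<Sum>k<n. u k)" by (simp add: summable_iff_convergent)
  then have "convergent (\<lambda>n. c n - (\<Sum>k<n. u k) + (\<Sum>k<n. w k))"
    using \<open>convergent c\<close> W by (intro convergent_add convergent_diff)
  then show "convergent a" by (simp add: c_def)
qed

text \<open>
  Switching the increments off for good at some time \<tau> leaves the telescoping sum up to \<tau>. For
  bounded c this bounds the stopped sum uniformly in T.
\<close>

lemma stopped_telescoping_sum:
  fixes c :: "nat \<Rightarrow> real" and I :: "nat \<Rightarrow> real"
  assumes I: "\<And>n. I n \<in> {0, 1}" "\<And>n. I (Suc n) \<le> I n"
  shows "\<exists>\<tau>. (\<Sum>n<T. I n * (c (Suc n) - c n)) = c \<tau> - c 0"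
proof -
  have "\<exists>\<tau>. (\<Sum>n<T. I n * (c (Suc n) - c n)) = c \<tau> - c 0 \<and> (I T = 1 \<longrightarrow> \<tau> = T)"
  proof (induction T)
    case (Suc T)
    then obtain \<tau> where \<tau>: "(\<Sum>n<T. I n * (c (Suc n) - c n)) = c \<tau> - c 0" "I T = 1 \<longrightarrow> \<tau> = T"
      by blast
    show ?case
    proof (cases "I T = 1")
      case True
      then show ?thesis using \<tau> by (intro exI[of _ "Suc T"]) simp
    next
      case False
      then have "I T = 0" "I (Suc T) \<noteq> 1" using I(1)[of T] I(2)[of T] by auto
      then show ?thesis using \<tau> by (intro exI[of _ \<tau>]) simp
    qed
  qed (auto intro: exI[of _ 0])
  then show ?thesis by blast
qed

text \<open>
  Write Y (n+1) = P n + m n with P n the conditional expectation given F n. If the martingale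
  differences m n are almost surely summable, the conclusion is the deterministic statement
  almost_decreasing_sequence. Only pathwise summability of e is available, not integrability, so the
  m n are first switched off when the partial sums of e exceed a level K. Then

    E[I n * (m n)^2] = E[I n * (c (Y (n+1)) - c (P n))]   for c y = y^2 - 2 C y,

  because the term linear in m n has mean zero. On [0, C] the function c decreases with slope at least
  -2 C, and P n exceeds Y n by at most e n, so c (P n) \<ge> c (Y n) - 2 C e n. The stopped increments of
  c (Y n) telescope to a bounded quantity and the stopped errors sum to at most K, which makes the stopped
  martingale differences square-summable. For almost every path no increment is switched off once K
  is large.
\<close>

theorem (in prob_space) bounded_robbins_siegmund:
  fixes Y e u :: "nat \<Rightarrow> 'a \<Rightarrow> real"
  assumes sub: "\<And>n. subalgebra M (F n)" and mono: "\<And>n. subalgebra (F (Suc n)) (F n)"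
    and YF: "\<And>n. Y n \<in> borel_measurable (F n)"
    and Y: "\<And>n \<omega>. \<omega> \<in> space M \<Longrightarrow> 0 \<le> Y n \<omega> \<and> Y n \<omega> \<le> C"
    and eF: "\<And>n. e n \<in> borel_measurable (F n)"
    and e0: "\<And>n \<omega>. \<omega> \<in> space M \<Longrightarrow> 0 \<le> e n \<omega>"
    and u0: "\<And>n \<omega>. \<omega> \<in> space M \<Longrightarrow> 0 \<le> u n \<omega>"
    and drift: "\<And>n. AE \<omega> in M. real_cond_exp M (F n) (Y (Suc n)) \<omega> \<le> Y n \<omega> - u n \<omega> + e n \<omega>"
    and e_sum: "AE \<omega> in M. summable (\<lambda>n. e n \<omega>)"
  shows "AE \<omega> in M. convergent (\<lambda>n. Y n \<omega>) \<and> summable (\<lambda>n. u n \<omega>)"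
proof -
  have C0: "0 \<le> C" using not_empty Y by (metis ex_in_conv order_trans)
  note FM = measurable_from_subalg[OF sub]
  have [measurable]: "Y n \<in> borel_measurable M" "e n \<in> borel_measurable M" for n
    using FM YF eF by blast+
  interpret S: finite_measure_subalgebra M "F n" for n
    using sub by unfold_locales
  \<comment> \<open>A conditional expectation is bounded only almost everywhere; clamping makes the bound hold everywhere.\<close>
  define P where "P = (\<lambda>n \<omega>. max 0 (min C (real_cond_exp M (F n) (Y (Suc n)) \<omega>)))"
  define m where "m = (\<lambda>n \<omega>. Y (Suc n) \<omega> - P n \<omega>)"
  have PF: "P n \<in> borel_measurable (F n)" for n unfolding P_def by measurable
  have [measurable]: "P n \<in> borel_measurable M" for n using FM PF by blast
  have Pb: "0 \<le> P n \<omega> \<and> P n \<omega> \<le> C" for n \<omega> unfolding P_def using C0 by auto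
  have IY: "integrable M (Y n)" for n
    by (rule integrable_bounded_real[where K = C]) (simp, metis Y abs_of_nonneg)
  have Prce: "AE \<omega> in M. P n \<omega> = real_cond_exp M (F n) (Y (Suc n)) \<omega>" for n
  proof -
    have "AE \<omega> in M. 0 \<le> real_cond_exp M (F n) (Y (Suc n)) \<omega>"
      by (rule S.real_cond_exp_ge_c[OF IY]) (use Y in \<open>auto intro!: AE_I2\<close>)
    moreover have "AE \<omega> in M. real_cond_exp M (F n) (Y (Suc n)) \<omega> \<le> C"
      by (rule S.real_cond_exp_le_c[OF IY]) (use Y in \<open>auto intro!: AE_I2\<close>)
    ultimately show ?thesis by eventually_elim (auto simp: P_def)
  qed
  have drift': "AE \<omega> in M. P n \<omega> \<le> Y n \<omega> - u n \<omega> + e n \<omega>" for n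
    using Prce[of n] drift[of n] by eventually_elim simp
  have m_orth: "expectation (\<lambda>\<omega>. W \<omega> * m n \<omega>) = 0"
    if W: "W \<in> borel_measurable (F n)" "\<And>\<omega>. \<omega> \<in> space M \<Longrightarrow> \<bar>W \<omega>\<bar> \<le> K" for n W K
  proof -
    have [measurable]: "W \<in> borel_measurable M" using FM W by blast
    have K0: "0 \<le> K" using not_empty W(2) by (metis abs_ge_zero ex_in_conv order_trans)
    have I1: "integrable M (\<lambda>\<omega>. W \<omega> * Y (Suc n) \<omega>)" "integrable M (\<lambda>\<omega>. W \<omega> * P n \<omega>)"
      by (rule integrable_bounded_real[where K = "K * C"], measurable,
          use W(2) Y Pb K0 in \<open>auto simp: abs_mult intro!: mult_mono\<close>)+
    have "expectation (\<lambda>\<omega>. W \<omega> * P n \<omega>) = expectation (\<lambda>\<omega>. W \<omega> * real_cond_exp M (F n) (Y (Suc n)) \<omega>)"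
      by (rule integral_cong_AE) (use Prce[of n] in auto)
    also have "\<dots> = expectation (\<lambda>\<omega>. W \<omega> * Y (Suc n) \<omega>)"
      by (rule S.real_cond_exp_intg(2)[OF I1(1) W(1)]) simp
    finally show ?thesis unfolding m_def using I1 by (simp add: right_diff_distrib)
  qed
  have stopped: "AE \<omega> in M. summable (\<lambda>n. (if (\<Sum>k<Suc n. e k \<omega>) \<le> real K then m n \<omega> else 0))" for K :: nat
  proof -
    \<comment> \<open>The sum includes e n, so I n is F n-measurable and I n = 1 bounds all errors incurred up to step n.\<close>
    define I where "I = (\<lambda>n \<omega>. if (\<Sum>k<Suc n. e k \<omega>) \<le> real K then 1 else 0 :: real)"
    have I01: "I n \<omega> \<in> {0, 1}" for n \<omega> by (simp add: I_def)
    have Idec: "I (Suc n) \<omega> \<le> I n \<omega>" if "\<omega> \<in> space M" for n \<omega>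
      using e0[OF that, of "Suc n"] by (simp add: I_def)
    have IF: "I n \<in> borel_measurable (F n)" for n
    proof -
      have [measurable]: "e k \<in> borel_measurable (F n)" if "k \<in> {..<Suc n}" for k
        using filtration_measurable[where F = F, OF mono _ eF, of k n] that by auto
      show ?thesis unfolding I_def by measurable
    qed
    have [measurable]: "I n \<in> borel_measurable M" for n using FM IF by blast
    interpret D: bounded_martingale_differences M F "\<lambda>n \<omega>. I n \<omega> * m n \<omega>" C
    proof
      show "(\<lambda>\<omega>. I n \<omega> * m n \<omega>) \<in> borel_measurable (F (Suc n))" for n
        unfolding m_def
        using measurable_from_subalg[OF mono IF] measurable_from_subalg[OF mono PF] YF by measurable
      show "\<bar>I n \<omega> * m n \<omega>\<bar> \<le> C" if "\<omega> \<in> space M" for n \<omega>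
        using I01[of n \<omega>] Y[OF that, of "Suc n"] Pb[of n \<omega>] C0 by (auto simp: m_def abs_le_iff)
      show "expectation (\<lambda>\<omega>. W \<omega> * (I n \<omega> * m n \<omega>)) = 0"
        if W: "W \<in> borel_measurable (F n)" "\<And>\<omega>. \<omega> \<in> space M \<Longrightarrow> \<bar>W \<omega>\<bar> \<le> K'" for n W K'
      proof -
        have "(\<lambda>\<omega>. W \<omega> * I n \<omega>) \<in> borel_measurable (F n)" using W IF by measurable
        moreover have "\<bar>W \<omega> * I n \<omega>\<bar> \<le> K'" if "\<omega> \<in> space M" for \<omega>
          using I01[of n \<omega>] W(2)[OF that] by (auto simp: abs_mult)
        ultimately show ?thesis
          using m_orth[of "\<lambda>\<omega>. W \<omega> * I n \<omega>" n K'] by (simp add: mult.assoc)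
      qed
    qed (fact sub mono)+
    \<comment> \<open>The majorant of the square of the stopped increment, up to a term of mean zero.\<close>
    define G where "G = (\<lambda>n \<omega>. I n \<omega> * (((Y (Suc n) \<omega>)\<^sup>2 - 2 * C * Y (Suc n) \<omega>) - ((Y n \<omega>)\<^sup>2 - 2 * C * Y n \<omega>))
        + 2 * C * (I n \<omega> * e n \<omega>))"
    have Ie_sum: "(\<Sum>n<T. I n \<omega> * e n \<omega>) \<le> real K" if "\<omega> \<in> space M" for T \<omega>
    proof (induction T)
      case (Suc T)
      show ?case
      proof (cases "I T \<omega> = 1")
        case True
        then have "(\<Sum>k<Suc T. e k \<omega>) \<le> real K" by (simp add: I_def split: if_splits)
        moreover have "(\<Sum>n<Suc T. I n \<omega> * e n \<omega>) \<le> (\<Sum>n<Suc T. e n \<omega>)"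
          using e0[OF that] by (intro sum_mono) (simp add: I_def)
        ultimately show ?thesis by linarith
      next
        case False
        then have "I T \<omega> = 0" using I01[of T \<omega>] by auto
        then show ?thesis using Suc by simp
      qed
    qed simp
    have Ie: "0 \<le> I n \<omega> * e n \<omega> \<and> I n \<omega> * e n \<omega> \<le> real K" if "\<omega> \<in> space M" for n \<omega>
    proof -
      have "I n \<omega> * e n \<omega> \<le> (\<Sum>n<Suc n. I n \<omega> * e n \<omega>)"
        using e0[OF that] by (intro member_le_sum) (auto simp: I_def)
      then show ?thesis using Ie_sum[OF that, of "Suc n"] e0[OF that] by (simp add: I_def)
    qed
    have cb: "- (C\<^sup>2) \<le> (Y n \<omega>)\<^sup>2 - 2 * C * Y n \<omega> \<and> (Y n \<omega>)\<^sup>2 - 2 * C * Y n \<omega> \<le> 0"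
      if "\<omega> \<in> space M" for n \<omega>
    proof -
      have "0 \<le> (C - Y n \<omega>)\<^sup>2" by simp
      moreover have "Y n \<omega> * Y n \<omega> \<le> 2 * C * Y n \<omega>"
        using Y[OF that, of n] by (intro mult_right_mono) auto
      ultimately show ?thesis by (simp add: power2_eq_square algebra_simps)
    qed
    have Gsum: "(\<Sum>n<T. G n \<omega>) \<le> C\<^sup>2 + 2 * C * real K" if \<omega>: "\<omega> \<in> space M" for T \<omega>
    proof -
      obtain \<tau> where \<tau>: "(\<Sum>n<T. I n \<omega> * (((Y (Suc n) \<omega>)\<^sup>2 - 2 * C * Y (Suc n) \<omega>) - ((Y n \<omega>)\<^sup>2 - 2 * C * Y n \<omega>)))
          = ((Y \<tau> \<omega>)\<^sup>2 - 2 * C * Y \<tau> \<omega>) - ((Y 0 \<omega>)\<^sup>2 - 2 * C * Y 0 \<omega>)"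
        using stopped_telescoping_sum[of "\<lambda>n. I n \<omega>" "\<lambda>n. (Y n \<omega>)\<^sup>2 - 2 * C * Y n \<omega>" T, OF I01 Idec[OF \<omega>]]
        by blast
      have "(\<Sum>n<T. G n \<omega>) \<le> C\<^sup>2 + 2 * C * (\<Sum>n<T. I n \<omega> * e n \<omega>)"
        unfolding G_def sum.distrib \<tau> using cb[OF \<omega>, of \<tau>] cb[OF \<omega>, of 0] by (simp add: sum_distrib_left)
      also have "\<dots> \<le> C\<^sup>2 + 2 * C * real K"
        using Ie_sum[OF \<omega>, of T] C0 by (simp add: mult_left_mono)
      finally show ?thesis .
    qed
    have IG: "integrable M (G n)" for n
    proof (rule integrable_bounded_real[where K = "C\<^sup>2 + 2 * C * real K"])
      show "G n \<in> borel_measurable M" unfolding G_def by measurable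
      show "\<bar>G n \<omega>\<bar> \<le> C\<^sup>2 + 2 * C * real K" if "\<omega> \<in> space M" for \<omega>
      proof -
        have "2 * C * (I n \<omega> * e n \<omega>) \<le> 2 * C * real K" "0 \<le> 2 * C * (I n \<omega> * e n \<omega>)"
          using Ie[OF that, of n] C0 by (auto intro: mult_left_mono)
        moreover have "\<bar>I n \<omega> * (((Y (Suc n) \<omega>)\<^sup>2 - 2 * C * Y (Suc n) \<omega>) - ((Y n \<omega>)\<^sup>2 - 2 * C * Y n \<omega>))\<bar> \<le> C\<^sup>2"
          using I01[of n \<omega>] cb[OF that, of n] cb[OF that, of "Suc n"] by (auto simp: abs_le_iff)
        ultimately show ?thesis unfolding G_def by linarith
      qed
    qed
    have var_le: "expectation (\<lambda>\<omega>. (I n \<omega> * m n \<omega>)\<^sup>2) \<le> expectation (G n)" for n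
    proof -
      \<comment> \<open>Expanding y^2 - 2 C y at P n leaves a term linear in m n; W is minus its coefficient and is known at time n.\<close>
      define W where "W = (\<lambda>\<omega>. I n \<omega> * (2 * C - 2 * P n \<omega>))"
      have WF: "W \<in> borel_measurable (F n)" unfolding W_def using IF[of n] PF[of n] by measurable
      have Wb: "\<bar>W \<omega>\<bar> \<le> 2 * C" for \<omega>
        using Pb[of n \<omega>] I01[of n \<omega>] C0 by (auto simp: W_def abs_le_iff)
      have [measurable]: "W \<in> borel_measurable M" using FM WF by blast
      have [measurable]: "m n \<in> borel_measurable M" unfolding m_def by measurable
      have mb: "\<bar>m n \<omega>\<bar> \<le> C" if "\<omega> \<in> space M" for \<omega>
        using Y[OF that, of "Suc n"] Pb[of n \<omega>] by (auto simp: m_def abs_le_iff)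
      have IWm: "integrable M (\<lambda>\<omega>. W \<omega> * m n \<omega>)"
        by (rule integrable_bounded_real[where K = "2 * C * C"], measurable)
           (use mult_mono[OF Wb mb] C0 in \<open>simp add: abs_mult\<close>)
      have ImI: "integrable M (\<lambda>\<omega>. (I n \<omega> * m n \<omega>)\<^sup>2)"
        by (rule integrable_bounded_real[where K = "C\<^sup>2"], measurable)
           (use D.bound[of _ n] C0 in \<open>simp add: abs_le_square_iff[of _ C, symmetric]\<close>)
      have "expectation (\<lambda>\<omega>. (I n \<omega> * m n \<omega>)\<^sup>2) \<le> expectation (\<lambda>\<omega>. G n \<omega> + W \<omega> * m n \<omega>)"
      proof (rule integral_mono_AE[OF ImI])
        show "integrable M (\<lambda>\<omega>. G n \<omega> + W \<omega> * m n \<omega>)" using IG IWm by simp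
        show "AE \<omega> in M. (I n \<omega> * m n \<omega>)\<^sup>2 \<le> G n \<omega> + W \<omega> * m n \<omega>"
          using drift'[of n] AE_space
        proof eventually_elim
          case (elim \<omega>)
          have "0 \<le> Y n \<omega> - P n \<omega> + e n \<omega>" using elim u0[of \<omega> n] by linarith
          then have "(Y n \<omega> - P n \<omega> + e n \<omega>) * (Y n \<omega> + P n \<omega>) \<le> (Y n \<omega> - P n \<omega> + e n \<omega>) * (2 * C)"
            using Y[OF elim(2), of n] Pb[of n \<omega>] by (intro mult_left_mono) auto
          moreover have "0 \<le> e n \<omega> * (Y n \<omega> + P n \<omega>)"
            using e0[OF elim(2), of n] Y[OF elim(2), of n] Pb[of n \<omega>] by simp
          ultimately have "(m n \<omega>)\<^sup>2 \<le> ((Y (Suc n) \<omega>)\<^sup>2 - 2 * C * Y (Suc n) \<omega>) - ((Y n \<omega>)\<^sup>2 - 2 * C * Y n \<omega>)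
              + 2 * C * e n \<omega> + (2 * C - 2 * P n \<omega>) * m n \<omega>"
            unfolding m_def by (simp add: power2_eq_square algebra_simps)
          then show ?case using I01[of n \<omega>] by (auto simp: G_def W_def)
        qed
      qed
      also have "\<dots> = expectation (G n)"
        using m_orth[OF WF Wb] IG IWm by simp
      finally show ?thesis .
    qed
    have "AE \<omega> in M. summable (\<lambda>n. I n \<omega> * m n \<omega>)"
    proof (rule D.martingale_difference_series_converges, rule summableI_nonneg_bounded)
      fix T
      have "(\<Sum>n<T. expectation (\<lambda>\<omega>. (I n \<omega> * m n \<omega>)\<^sup>2)) \<le> (\<Sum>n<T. expectation (G n))"
        by (intro sum_mono var_le)
      also have "\<dots> = expectation (\<lambda>\<omega>. \<Sum>n<T. G n \<omega>)"
        using IG by simp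
      also have "\<dots> \<le> expectation (\<lambda>\<omega>. C\<^sup>2 + 2 * C * real K)"
        using IG Gsum by (intro integral_mono) auto
      finally show "(\<Sum>n<T. expectation (\<lambda>\<omega>. (I n \<omega> * m n \<omega>)\<^sup>2)) \<le> C\<^sup>2 + 2 * C * real K"
        by (simp add: prob_space)
    qed simp
    then show ?thesis by eventually_elim (simp add: I_def if_distrib[of "\<lambda>i. i * _"] cong: if_cong)
  qed
  have "AE \<omega> in M. \<forall>K::nat. summable (\<lambda>n. (if (\<Sum>k<Suc n. e k \<omega>) \<le> real K then m n \<omega> else 0))"
    using stopped by (simp add: AE_all_countable)
  moreover have "AE \<omega> in M. \<forall>n. P n \<omega> \<le> Y n \<omega> - u n \<omega> + e n \<omega>"
    using drift' by (simp add: AE_all_countable)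
  ultimately show ?thesis using e_sum AE_space
  proof eventually_elim
    case (elim \<omega>)
    obtain K :: nat where K: "(\<Sum>n. e n \<omega>) \<le> real K" using real_arch_simple by blast
    have "(\<Sum>k<Suc n. e k \<omega>) \<le> real K" for n
      using sum_le_suminf[OF elim(3), of "{..<Suc n}"] e0[OF elim(4)] K by (meson finite_lessThan order_trans)
    then have "summable (\<lambda>n. m n \<omega>)" using spec[OF elim(1), of K] by simp
    then have "summable (\<lambda>n. m n \<omega> + e n \<omega>)" using elim(3) by (rule summable_add)
    moreover have "Y (Suc n) \<omega> \<le> Y n \<omega> - u n \<omega> + (m n \<omega> + e n \<omega>)" for n
      using elim(2) unfolding m_def by (smt (verit))
    moreover have "0 \<le> Y n \<omega>" "0 \<le> u n \<omega>" for n using Y[OF elim(4)] u0[OF elim(4)] by auto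
    ultimately show ?case
      using almost_decreasing_sequence[of "\<lambda>n. Y n \<omega>" "\<lambda>n. u n \<omega>" "\<lambda>n. m n \<omega> + e n \<omega>"]
      by blast
  qed
qed

section \<open>Bregman divergences and the mirror step\<close>

lemma GDERIV_directional_limit:
  fixes F :: "'a::real_inner \<Rightarrow> real"
  assumes "GDERIV F y :> D"
  shows "((\<lambda>u. (F (y + u *\<^sub>R h) - F y) / u) \<longlongrightarrow> D \<bullet> h) (at 0)"
proof -
  have "((\<lambda>u. y + u *\<^sub>R h) has_derivative (\<lambda>u. u *\<^sub>R h)) (at 0)"
    by (auto intro!: derivative_eq_intros)
  moreover have "(F has_derivative (\<lambda>h. h \<bullet> D)) (at (y + 0 *\<^sub>R h))"
    using assms by (simp add: gderiv_def)
  ultimately have "((\<lambda>u. F (y + u *\<^sub>R h)) has_derivative (\<lambda>u. (u *\<^sub>R h) \<bullet> D)) (at 0)"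
    by (rule has_derivative_compose)
  then have "DERIV (\<lambda>u. F (y + u *\<^sub>R h)) 0 :> D \<bullet> h"
    by (simp add: has_field_derivative_def inner_commute mult_commute_abs)
  then show ?thesis by (simp add: DERIV_def)
qed

text \<open>
  Strong convexity is required for the Euclidean norm. An arbitrary norm is reduced to this case by
  strongly_convex_on_euclidean below.
\<close>

locale mirror_map =
  fixes X U :: "'a::euclidean_space set" and R :: "'a \<Rightarrow> real" and s :: real
  assumes X_ne: "X \<noteq> {}" and X_convex: "convex X" and X_compact: "compact X"
    and U_open: "open U" and XU: "X \<subseteq> U" and s_pos: "0 < s"
    and R_strong: "strongly_convex_on U norm s R"
    and R_diff: "\<And>y. y \<in> U \<Longrightarrow> R differentiable (at y)"
begin

lemma directional_limit:
  assumes "y \<in> U"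
  shows "((\<lambda>u. (R (y + u *\<^sub>R h) - R y) / u) \<longlongrightarrow> gradient R y \<bullet> h) (at 0)"
  using GDERIV_directional_limit[OF GDERIV_gradient[OF R_diff[OF assms]]] .

lemma R_continuous: "continuous_on U R"
  using R_diff differentiable_imp_continuous_on by (meson differentiable_at_imp_differentiable_on)

text \<open>
  The strong convexity inequality along the segment from y to x, divided by the step u, has this
  inequality as its limit for u \<longlonglongrightarrow> 0.
\<close>

lemma bregman_lower_bound:
  assumes x: "x \<in> U" and y: "y \<in> U"
  shows "s / 2 * (norm (x - y))\<^sup>2 \<le> bregman R x y"
proof -
  have "gradient R y \<bullet> (x - y) \<le> R x - R y - s / 2 * (1 - 0) * (norm (x - y))\<^sup>2"
  proof (rule tendsto_le[of "at_right (0::real)"])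
    show "((\<lambda>u. (R (y + u *\<^sub>R (x - y)) - R y) / u) \<longlongrightarrow> gradient R y \<bullet> (x - y)) (at_right 0)"
      by (rule tendsto_mono[OF _ directional_limit[OF y]]) (simp add: at_within_le_nhds at_le)
    show "((\<lambda>u. R x - R y - s / 2 * (1 - u) * (norm (x - y))\<^sup>2)
        \<longlongrightarrow> R x - R y - s / 2 * (1 - 0) * (norm (x - y))\<^sup>2) (at_right 0)"
      by (intro tendsto_intros)
    have "(R (y + u *\<^sub>R (x - y)) - R y) / u \<le> R x - R y - s / 2 * (1 - u) * (norm (x - y))\<^sup>2"
      if u: "u \<in> {0<..<1}" for u
    proof -
      have "R ((1 - u) *\<^sub>R y + u *\<^sub>R x) \<le> (1 - u) * R y + u * R x - s / 2 * u * (1 - u) * (norm (y - x))\<^sup>2"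
        using R_strong x y u unfolding strongly_convex_on_def by force
      also have "(1 - u) *\<^sub>R y + u *\<^sub>R x = y + u *\<^sub>R (x - y)" by (simp add: algebra_simps)
      finally have "R (y + u *\<^sub>R (x - y)) - R y \<le> u * (R x - R y - s / 2 * (1 - u) * (norm (x - y))\<^sup>2)"
        by (simp add: algebra_simps norm_minus_commute)
      then show ?thesis using u by (simp add: divide_le_eq mult.commute)
    qed
    then show "\<forall>\<^sub>F u in at_right 0. (R (y + u *\<^sub>R (x - y)) - R y) / u
        \<le> R x - R y - s / 2 * (1 - u) * (norm (x - y))\<^sup>2"
      by (rule eventually_mono[OF eventually_at_right_real[OF zero_less_one]])
  qed simp
  then show ?thesis by (simp add: bregman_def)
qed

lemma bregman_nonneg: "x \<in> U \<Longrightarrow> y \<in> U \<Longrightarrow> 0 \<le> bregman R x y"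
  using order_trans[OF _ bregman_lower_bound[of x y]] s_pos by simp

text \<open>
  The first-order optimality condition for minimizing R z - \<theta> \<bullet> z over X. The mirror step
  is of this form with \<theta> = \<nabla>R(x) - a v.
\<close>

definition variational_solution :: "'a \<Rightarrow> 'a \<Rightarrow> bool" where
  "variational_solution \<theta> p \<longleftrightarrow> p \<in> X \<and> (\<forall>z\<in>X. 0 \<le> (gradient R p - \<theta>) \<bullet> (z - p))"

lemma minimizer_variational_solution:
  assumes p: "p \<in> X" and min: "\<And>z. z \<in> X \<Longrightarrow> R p - \<theta> \<bullet> p \<le> R z - \<theta> \<bullet> z"
  shows "variational_solution \<theta> p"
proof -
  have "0 \<le> (gradient R p - \<theta>) \<bullet> (z - p)" if z: "z \<in> X" for z
  proof -
    have "\<theta> \<bullet> (z - p) \<le> gradient R p \<bullet> (z - p)"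
    proof (rule tendsto_lowerbound)
      show "((\<lambda>u. (R (p + u *\<^sub>R (z - p)) - R p) / u) \<longlongrightarrow> gradient R p \<bullet> (z - p)) (at_right 0)"
        by (rule tendsto_mono[OF _ directional_limit]) (use p XU in \<open>auto simp: at_le\<close>)
      have "\<theta> \<bullet> (z - p) \<le> (R (p + u *\<^sub>R (z - p)) - R p) / u" if u: "u \<in> {0<..<1}" for u
      proof -
        have "(1 - u) *\<^sub>R p + u *\<^sub>R z \<in> X"
          using u p z by (intro convexD[OF X_convex]) auto
        moreover have "(1 - u) *\<^sub>R p + u *\<^sub>R z = p + u *\<^sub>R (z - p)" by (simp add: algebra_simps)
        ultimately have "R p - \<theta> \<bullet> p \<le> R (p + u *\<^sub>R (z - p)) - \<theta> \<bullet> (p + u *\<^sub>R (z - p))"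
          using min by metis
        then show ?thesis using u by (simp add: le_divide_eq inner_right_distrib inner_diff_right mult.commute)
      qed
      then show "\<forall>\<^sub>F u in at_right 0. \<theta> \<bullet> (z - p) \<le> (R (p + u *\<^sub>R (z - p)) - R p) / u"
        by (rule eventually_mono[OF eventually_at_right_real[OF zero_less_one]])
    qed simp
    then show ?thesis by (simp add: inner_diff_left)
  qed
  then show ?thesis using p by (simp add: variational_solution_def)
qed

lemma variational_solution_exists: "\<exists>p. variational_solution \<theta> p"
proof -
  have "continuous_on X (\<lambda>z. R z - \<theta> \<bullet> z)"
    using continuous_on_subset[OF R_continuous XU] by (intro continuous_intros)
  then obtain p where "p \<in> X" "\<forall>z\<in>X. R p - \<theta> \<bullet> p \<le> R z - \<theta> \<bullet> z"
    using continuous_attains_inf[OF X_compact X_ne] by blast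
  then show ?thesis using minimizer_variational_solution by blast
qed

text \<open>
  Testing each condition with the other solution and adding shows that the gradient of R is monotone
  against \<theta> - \<eta>, and strong convexity makes that monotonicity quantitative. Both uniqueness
  of the mirror step and its measurability in the data come from this estimate.
\<close>

lemma variational_solution_Lipschitz:
  assumes p: "variational_solution \<theta> p" and q: "variational_solution \<eta> q"
  shows "s * norm (p - q) \<le> norm (\<theta> - \<eta>)"
proof -
  have pq: "p \<in> X" "q \<in> X" "p \<in> U" "q \<in> U" using p q XU by (auto simp: variational_solution_def)
  have "s * (norm (p - q))\<^sup>2 \<le> bregman R p q + bregman R q p"
    using bregman_lower_bound[of p q] bregman_lower_bound[of q p] pq by (simp add: norm_minus_commute)
  also have "\<dots> = (gradient R p - gradient R q) \<bullet> (p - q)"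
    by (simp add: bregman_def inner_diff_left inner_diff_right)
  also have "\<dots> \<le> (\<theta> - \<eta>) \<bullet> (p - q)"
  proof -
    have "0 \<le> (gradient R p - \<theta>) \<bullet> (q - p)" "0 \<le> (gradient R q - \<eta>) \<bullet> (p - q)"
      using p q pq by (auto simp: variational_solution_def)
    then show ?thesis by (simp add: inner_diff_left inner_diff_right)
  qed
  also have "\<dots> \<le> norm (\<theta> - \<eta>) * norm (p - q)" by (rule norm_cauchy_schwarz)
  finally have "(s * norm (p - q)) * norm (p - q) \<le> norm (\<theta> - \<eta>) * norm (p - q)"
    by (simp add: power2_eq_square mult.assoc)
  then show ?thesis
    by (cases "p = q") (auto dest: mult_right_le_imp_le)
qed

definition mirror_projection :: "'a \<Rightarrow> 'a" where
  "mirror_projection \<theta> = (SOME p. variational_solution \<theta> p)"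

lemma mirror_projection_eq:
  assumes "variational_solution \<theta> p"
  shows "mirror_projection \<theta> = p"
proof -
  have "variational_solution \<theta> (mirror_projection \<theta>)"
    unfolding mirror_projection_def by (rule someI_ex[OF variational_solution_exists])
  then have "s * norm (mirror_projection \<theta> - p) \<le> 0"
    using variational_solution_Lipschitz[OF _ assms] by fastforce
  then show ?thesis using s_pos by (simp add: mult_le_0_iff)
qed

lemma continuous_mirror_projection: "continuous_on UNIV mirror_projection"
proof -
  have "dist (mirror_projection \<theta>) (mirror_projection \<eta>) \<le> (1 / s) * dist \<theta> \<eta>" for \<theta> \<eta>
  proof -
    obtain p q where "variational_solution \<theta> p" "variational_solution \<eta> q"
      using variational_solution_exists by blast
    then show ?thesis
      using variational_solution_Lipschitz[of \<theta> p \<eta> q] s_pos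
      by (simp add: mirror_projection_eq dist_norm field_simps)
  qed
  then have "(1 / s)-lipschitz_on UNIV mirror_projection"
    using s_pos by (intro lipschitz_onI) auto
  then show ?thesis by (rule lipschitz_on_continuous_on)
qed

lemma mirror_step_variational:
  assumes "0 < a" "x \<in> X"
    and step: "is_arg_min (\<lambda>z. v \<bullet> (z - x) + 1 / a * bregman R z x) (\<lambda>z. z \<in> X) y"
  shows "variational_solution (gradient R x - a *\<^sub>R v) y"
proof (rule minimizer_variational_solution)
  show "y \<in> X" using step by (simp add: is_arg_min_def)
  fix z assume "z \<in> X"
  then have "v \<bullet> (y - x) + 1 / a * bregman R y x \<le> v \<bullet> (z - x) + 1 / a * bregman R z x"
    using step by (auto simp: is_arg_min_def not_less)
  then have "a * (v \<bullet> (y - x) + 1 / a * bregman R y x) \<le> a * (v \<bullet> (z - x) + 1 / a * bregman R z x)"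
    using \<open>0 < a\<close> by (intro mult_left_mono) auto
  then have "a * (v \<bullet> (y - x)) + bregman R y x \<le> a * (v \<bullet> (z - x)) + bregman R z x"
    using \<open>0 < a\<close> by (simp add: distrib_left)
  then show "R y - (gradient R x - a *\<^sub>R v) \<bullet> y \<le> R z - (gradient R x - a *\<^sub>R v) \<bullet> z"
    by (simp add: bregman_def inner_diff_left inner_diff_right algebra_simps)
qed

text \<open>
  The three-point identity for Bregman divergences together with the optimality condition at y gives
  D(z, y) \<le> D(z, x) - D(y, x) + a v \<bullet> (z - y). Moving from z - y to z - x costs a v \<bullet> (x - y), which
  Young's inequality splits into the quadratic error and a part absorbed by D(y, x).
\<close>

lemma mirror_step_bregman:
  assumes a: "0 < a" and x: "x \<in> X" and z: "z \<in> X"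
    and y: "variational_solution (gradient R x - a *\<^sub>R v) y"
  shows "bregman R z y \<le> bregman R z x + a * (v \<bullet> (z - x)) + a\<^sup>2 * (norm v)\<^sup>2 / (2 * s)"
proof -
  have yX: "y \<in> X" using y by (simp add: variational_solution_def)
  have "0 \<le> (gradient R y - (gradient R x - a *\<^sub>R v)) \<bullet> (z - y)"
    using y z by (simp add: variational_solution_def)
  moreover have "bregman R z y = bregman R z x - bregman R y x - (gradient R y - gradient R x) \<bullet> (z - y)"
    by (simp add: bregman_def inner_diff_left inner_diff_right)
  ultimately have "bregman R z y \<le> bregman R z x - bregman R y x + a * (v \<bullet> (z - y))"
    by (simp add: inner_diff_left inner_add_left)
  also have "a * (v \<bullet> (z - y)) = a * (v \<bullet> (z - x)) + a * (v \<bullet> (x - y))"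
    by (simp add: inner_diff_right algebra_simps)
  also have "a * (v \<bullet> (x - y)) \<le> a\<^sup>2 * (norm v)\<^sup>2 / (2 * s) + s / 2 * (norm (y - x))\<^sup>2"
  proof -
    have "a * (v \<bullet> (x - y)) \<le> (a * norm v) * norm (y - x)"
      using a norm_cauchy_schwarz[of v "x - y"] by (simp add: norm_minus_commute mult.assoc)
    moreover have "0 \<le> (a * norm v - s * norm (y - x))\<^sup>2 / (2 * s)" using s_pos by simp
    moreover have "(a * norm v - s * norm (y - x))\<^sup>2 / (2 * s)
        = a\<^sup>2 * (norm v)\<^sup>2 / (2 * s) + s / 2 * (norm (y - x))\<^sup>2 - (a * norm v) * norm (y - x)"
      using s_pos by (simp add: field_simps power2_eq_square)
    ultimately show ?thesis by linarith
  qed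
  also have "s / 2 * (norm (y - x))\<^sup>2 \<le> bregman R y x"
    using bregman_lower_bound yX x XU by blast
  finally show ?thesis by simp
qed

text \<open>
  R is bounded on a compact neighbourhood of X inside U. A convex function cannot have a large
  gradient at y without a large increase over a step of length \<epsilon> in the direction of that gradient.
\<close>

lemma gradient_bounded: "\<exists>G>0. \<forall>y\<in>X. norm (gradient R y) \<le> G"
proof -
  obtain \<epsilon> where \<epsilon>: "\<epsilon> > 0" "{y. infdist y X \<le> \<epsilon>} \<subseteq> U"
    using compact_in_open_separated[OF X_ne X_compact U_open XU] by blast
  define K where "K = {y. infdist y X \<le> \<epsilon>}"
  have "compact K" unfolding K_def by (rule compact_infdist_le[OF X_ne X_compact \<epsilon>(1)])
  then have "compact (R ` K)"
    using compact_continuous_image continuous_on_subset[OF R_continuous \<epsilon>(2)] K_def by blast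
  then obtain B where B: "\<And>y. y \<in> K \<Longrightarrow> \<bar>R y\<bar> \<le> B"
    using compact_imp_bounded bounded_iff by (metis imageI real_norm_def)
  have "norm (gradient R y) \<le> 2 * B / \<epsilon>" if y: "y \<in> X" for y
  proof (cases "gradient R y = 0")
    case True
    have "0 \<le> B" using B[of y] y \<epsilon>(1) by (simp add: K_def)
    then show ?thesis using True \<epsilon>(1) by simp
  next
    case False
    define h where "h = (\<epsilon> / norm (gradient R y)) *\<^sub>R gradient R y"
    have "norm h = \<epsilon>" using False \<epsilon>(1) by (simp add: h_def)
    then have "infdist (y + h) X \<le> \<epsilon>"
      using infdist_le[OF y, of "y + h"] by (simp add: dist_norm)
    then have yh: "y + h \<in> K" "y \<in> K" using y \<epsilon>(1) by (simp_all add: K_def)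
    then have "0 \<le> bregman R (y + h) y"
      using bregman_nonneg \<epsilon>(2) K_def by blast
    then have "\<epsilon> * norm (gradient R y) \<le> R (y + h) - R y"
      using False by (simp add: bregman_def h_def power2_norm_eq_inner[symmetric] power2_eq_square)
    also have "\<dots> \<le> 2 * B" using B[OF yh(1)] B[OF yh(2)] by (simp add: abs_le_iff)
    finally show ?thesis using \<epsilon>(1) by (simp add: field_simps)
  qed
  then have "\<forall>y\<in>X. norm (gradient R y) \<le> max 1 (2 * B / \<epsilon>)" by fastforce
  then show ?thesis by (intro exI[of _ "max 1 (2 * B / \<epsilon>)"]) auto
qed

lemma R_Lipschitz:
  assumes G: "\<And>y. y \<in> X \<Longrightarrow> norm (gradient R y) \<le> G" and "x \<in> X" "y \<in> X"
  shows "R x - R y \<le> G * norm (x - y)"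
proof -
  have "0 \<le> bregman R y x" using bregman_nonneg assms XU by blast
  then have "R x - R y \<le> gradient R x \<bullet> (x - y)"
    by (simp add: bregman_def inner_diff_right)
  also have "\<dots> \<le> norm (gradient R x) * norm (x - y)" by (rule norm_cauchy_schwarz)
  also have "\<dots> \<le> G * norm (x - y)" using G assms by (intro mult_right_mono) auto
  finally show ?thesis .
qed

lemma bregman_Lipschitz:
  assumes G: "\<And>y. y \<in> X \<Longrightarrow> norm (gradient R y) \<le> G" and "z \<in> X" "w \<in> X" "y \<in> X"
  shows "bregman R z y - bregman R w y \<le> 2 * G * norm (z - w)"
proof -
  have "bregman R z y - bregman R w y = R z - R w + gradient R y \<bullet> (w - z)"
    by (simp add: bregman_def inner_diff_right)
  also have "R z - R w \<le> G * norm (z - w)" by (rule R_Lipschitz) (use assms in auto)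
  also have "gradient R y \<bullet> (w - z) \<le> norm (gradient R y) * norm (w - z)" by (rule norm_cauchy_schwarz)
  also have "\<dots> \<le> G * norm (w - z)" using assms by (intro mult_right_mono) auto
  finally show ?thesis by (simp add: norm_minus_commute)
qed

lemma bregman_bounded:
  assumes G: "\<And>y. y \<in> X \<Longrightarrow> norm (gradient R y) \<le> G" and "z \<in> X" "y \<in> X"
  shows "bregman R z y \<le> 2 * G * norm (z - y)"
  using bregman_Lipschitz[OF G, of z y y] assms by (simp add: bregman_def)

text \<open>
  The limit of D(z, x n) can be read off along the subsequence: for z close to p it is small, because
  D(z, x (r k)) is at most a multiple of the distance of z and x (r k). The Lipschitz bound in the first
  argument transfers this to D(p, x n) along the whole sequence.
\<close>

lemma bregman_convergence:
  fixes x :: "nat \<Rightarrow> 'a"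
  assumes x: "\<And>n. x n \<in> X" and Q: "Q \<subseteq> X" and p: "p \<in> X" "p \<in> closure Q"
    and conv: "\<And>z. z \<in> Q \<Longrightarrow> convergent (\<lambda>n. bregman R z (x n))"
    and r: "filterlim r at_top sequentially" "(\<lambda>k. x (r k)) \<longlonglongrightarrow> p"
  shows "x \<longlonglongrightarrow> p"
proof -
  obtain G where G: "0 < G" "\<And>y. y \<in> X \<Longrightarrow> norm (gradient R y) \<le> G"
    using gradient_bounded by blast
  have "(\<lambda>n. bregman R p (x n)) \<longlonglongrightarrow> 0"
  proof (rule LIMSEQ_I)
    fix \<epsilon> :: real assume "0 < \<epsilon>"
    \<comment> \<open>The error is at most 2 G \<delta> from the limit along the subsequence plus 2 G \<delta> from moving z to p.\<close>
    define \<delta> where "\<delta> = \<epsilon> / (5 * G)"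
    have \<delta>: "0 < \<delta>" using \<open>0 < \<epsilon>\<close> G(1) by (simp add: \<delta>_def)
    obtain z where z: "z \<in> Q" "dist z p < \<delta>"
      using p(2) \<delta> unfolding closure_approachable by blast
    have zp: "norm (z - p) < \<delta>" "norm (p - z) < \<delta>" using z by (simp_all add: dist_norm norm_minus_commute)
    obtain l where l: "(\<lambda>n. bregman R z (x n)) \<longlonglongrightarrow> l"
      using conv[OF z(1)] by (auto simp: convergent_def)
    have "(\<lambda>k. bregman R z (x (r k))) \<longlonglongrightarrow> l"
      using filterlim_compose[OF l r(1)] .
    moreover have "(\<lambda>k. 2 * G * norm (z - x (r k))) \<longlonglongrightarrow> 2 * G * norm (z - p)"
      by (intro tendsto_intros r)
    ultimately have "l \<le> 2 * G * norm (z - p)"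
      using bregman_bounded[OF G(2)] z Q x by (intro LIMSEQ_le) auto
    also have "\<dots> < 2 * G * \<delta>" using zp G(1) by simp
    finally have "\<forall>\<^sub>F n in sequentially. bregman R z (x n) < 2 * G * \<delta>"
      using l by (intro order_tendstoD(2))
    then have "\<forall>\<^sub>F n in sequentially. norm (bregman R p (x n) - 0) < \<epsilon>"
    proof eventually_elim
      case (elim n)
      have "bregman R p (x n) - bregman R z (x n) \<le> 2 * G * norm (p - z)"
        using bregman_Lipschitz[OF G(2)] p z Q x by blast
      also have "\<dots> \<le> 2 * G * \<delta>" using zp G(1) by simp
      finally have "bregman R p (x n) < 5 * G * \<delta>"
        using elim mult_pos_pos[OF G(1) \<delta>] by (simp only: mult.assoc)
      moreover have "0 \<le> bregman R p (x n)" using bregman_nonneg p x XU by blast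
      ultimately show ?case using G(1) by (simp add: \<delta>_def)
    qed
    then show "\<exists>n0. \<forall>n\<ge>n0. norm (bregman R p (x n) - 0) < \<epsilon>"
      by (simp add: eventually_sequentially)
  qed
  then have "(\<lambda>n. bregman R p (x n) * (2 / s)) \<longlonglongrightarrow> 0 * (2 / s)" by (intro tendsto_intros)
  then have 0: "(\<lambda>n. bregman R p (x n) * (2 / s)) \<longlonglongrightarrow> 0" by simp
  have "(\<lambda>n. (norm (p - x n))\<^sup>2) \<longlonglongrightarrow> 0"
  proof (rule tendsto_sandwich[OF _ _ tendsto_const 0])
    show "\<forall>\<^sub>F n in sequentially. (norm (p - x n))\<^sup>2 \<le> bregman R p (x n) * (2 / s)"
    proof (intro always_eventually allI)
      fix n
      have "s / 2 * (norm (p - x n))\<^sup>2 \<le> bregman R p (x n)"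
        using bregman_lower_bound p x XU by blast
      then show "(norm (p - x n))\<^sup>2 \<le> bregman R p (x n) * (2 / s)"
        using s_pos by (simp add: field_simps)
    qed
  qed simp
  from tendsto_real_sqrt[OF this] have "(\<lambda>n. dist (x n) p) \<longlonglongrightarrow> 0"
    by (simp add: dist_norm norm_minus_commute)
  then show ?thesis by (subst tendsto_dist_iff)
qed

text \<open>
  The gradient is a pointwise limit of difference quotients, which are Borel
  functions once R is extended by 0 outside the open set U.
\<close>

lemma gradient_measurable:
  assumes x: "x \<in> borel_measurable M" and xU: "\<And>\<omega>. \<omega> \<in> space M \<Longrightarrow> x \<omega> \<in> U"
  shows "(\<lambda>\<omega>. gradient R (x \<omega>)) \<in> borel_measurable M"
proof (rule iffD2[OF borel_measurable_euclidean_space], rule)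
  fix i :: 'a assume "i \<in> Basis"
  define R' where "R' = (\<lambda>y. indicator U y *\<^sub>R R y)"
  have [measurable]: "R' \<in> borel_measurable borel"
    unfolding R'_def using U_open R_continuous by (intro borel_measurable_continuous_on_indicator) auto
  have eq: "R' y = R y" if "y \<in> U" for y using that by (simp add: R'_def)
  show "(\<lambda>\<omega>. gradient R (x \<omega>) \<bullet> i) \<in> borel_measurable M"
  proof (rule borel_measurable_LIMSEQ_real)
    show "(\<lambda>\<omega>. (R' (x \<omega> + inverse (real (Suc n)) *\<^sub>R i) - R' (x \<omega>)) / inverse (real (Suc n))) \<in> borel_measurable M" for n
      using x by measurable
    fix \<omega> assume "\<omega> \<in> space M"
    then have U: "x \<omega> \<in> U" by (rule xU)
    have "filterlim (\<lambda>n. inverse (real (Suc n))) (at 0) sequentially"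
      using LIMSEQ_inverse_real_of_nat by (intro filterlim_atI) auto
    then have lim: "(\<lambda>n. (R (x \<omega> + inverse (real (Suc n)) *\<^sub>R i) - R (x \<omega>)) / inverse (real (Suc n)))
        \<longlonglongrightarrow> gradient R (x \<omega>) \<bullet> i"
      by (rule filterlim_compose[OF directional_limit[OF U]])
    have "(\<lambda>n. x \<omega> + inverse (real (Suc n)) *\<^sub>R i) \<longlonglongrightarrow> x \<omega> + 0 *\<^sub>R i"
      by (intro tendsto_intros LIMSEQ_inverse_real_of_nat)
    then have "\<forall>\<^sub>F n in sequentially. x \<omega> + inverse (real (Suc n)) *\<^sub>R i \<in> U"
      using U U_open by (intro topological_tendstoD) auto
    then show "(\<lambda>n. (R' (x \<omega> + inverse (real (Suc n)) *\<^sub>R i) - R' (x \<omega>)) / inverse (real (Suc n)))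
        \<longlonglongrightarrow> gradient R (x \<omega>) \<bullet> i"
      by (intro Lim_transform_eventually[OF lim]) (auto elim!: eventually_mono simp: eq U)
  qed
qed

lemma bregman_measurable:
  assumes x: "x \<in> borel_measurable M" and xU: "\<And>\<omega>. \<omega> \<in> space M \<Longrightarrow> x \<omega> \<in> U"
  shows "(\<lambda>\<omega>. bregman R z (x \<omega>)) \<in> borel_measurable M"
proof -
  have "(\<lambda>y. indicator U y *\<^sub>R R y) \<in> borel_measurable borel"
    using U_open R_continuous by (intro borel_measurable_continuous_on_indicator) auto
  from measurable_compose[OF x this] have "(\<lambda>\<omega>. R (x \<omega>)) \<in> borel_measurable M"
    by (rule measurable_cong[THEN iffD1, rotated]) (simp add: xU)
  then show ?thesis
    unfolding bregman_def using gradient_measurable[OF x xU] x by measurable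
qed

text \<open>
  The new iterate is a continuous function (the mirror projection) of the measurable vector
  \<nabla>R(x) - a v.
\<close>

lemma mirror_step_measurable:
  assumes x: "x \<in> borel_measurable M" "\<And>\<omega>. \<omega> \<in> space M \<Longrightarrow> x \<omega> \<in> X"
    and v: "v \<in> borel_measurable M"
    and y: "\<And>\<omega>. \<omega> \<in> space M \<Longrightarrow> variational_solution (gradient R (x \<omega>) - a *\<^sub>R v \<omega>) (y \<omega>)"
  shows "y \<in> borel_measurable M"
proof -
  have "(\<lambda>\<omega>. gradient R (x \<omega>) - a *\<^sub>R v \<omega>) \<in> borel_measurable M"
    using gradient_measurable[OF x(1)] x(2) XU v by (intro borel_measurable_diff borel_measurable_scaleR) auto
  from measurable_compose[OF this borel_measurable_continuous_onI[OF continuous_mirror_projection]]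
  show ?thesis
    by (rule measurable_cong[THEN iffD1, rotated]) (simp add: mirror_projection_eq[OF y])
qed

end

section \<open>Comparison with the Euclidean norm\<close>

lemma is_norm_bounds:
  fixes N :: "'a::euclidean_space \<Rightarrow> real"
  assumes N: "is_norm N"
  obtains c C where "0 < c" "0 < C" "\<And>x. c * norm x \<le> N x" "\<And>x. N x \<le> C * norm x"
proof -
  have N0: "\<And>x. 0 \<le> N x" and N_eq: "\<And>x. N x = 0 \<longleftrightarrow> x = 0"
    and N_scale: "\<And>c x. N (c *\<^sub>R x) = \<bar>c\<bar> * N x" and N_tri: "\<And>x y. N (x + y) \<le> N x + N y"
    using N by (auto simp: is_norm_def)
  define C where "C = 1 + (\<Sum>b\<in>Basis. N b)"
  have C: "0 < C" unfolding C_def using N0 by (simp add: add_pos_nonneg sum_nonneg)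
  have N_sum: "N (\<Sum>b\<in>B. f b) \<le> (\<Sum>b\<in>B. N (f b))" if "finite B" for B and f :: "'a \<Rightarrow> 'a"
    using that
  proof (induction B rule: finite_induct)
    case empty
    then show ?case using N_eq[of 0] by simp
  next
    case (insert b B)
    then show ?case using N_tri[of "f b" "sum f B"] by simp
  qed
  have upper: "N x \<le> C * norm x" for x
  proof -
    have "N x = N (\<Sum>b\<in>Basis. (x \<bullet> b) *\<^sub>R b)" by (simp add: euclidean_representation)
    also have "\<dots> \<le> (\<Sum>b\<in>Basis. N ((x \<bullet> b) *\<^sub>R b))" by (rule N_sum) simp
    also have "\<dots> \<le> (\<Sum>b\<in>Basis. norm x * N b)"
      unfolding N_scale by (intro sum_mono mult_right_mono Basis_le_norm N0)
    also have "\<dots> \<le> C * norm x" by (simp add: C_def sum_distrib_left algebra_simps)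
    finally show ?thesis .
  qed
  have diff: "N x - N y \<le> C * norm (x - y)" for x y
    using N_tri[of "x - y" y] upper[of "x - y"] by simp
  have "C-lipschitz_on (sphere 0 1) N"
  proof (rule lipschitz_onI)
    fix x y show "dist (N x) (N y) \<le> C * dist x y"
      using diff[of x y] diff[of y x] by (simp add: dist_norm norm_minus_commute abs_le_iff)
  qed (use C in simp)
  then have "continuous_on (sphere 0 1) N" by (rule lipschitz_on_continuous_on)
  moreover have "compact (sphere (0::'a) 1)" "sphere (0::'a) 1 \<noteq> {}" by auto
  ultimately obtain w where w: "w \<in> sphere 0 1" "\<And>y. y \<in> sphere 0 1 \<Longrightarrow> N w \<le> N y"
    using continuous_attains_inf by metis
  have "w \<noteq> 0" using w(1) by auto
  then have w0: "0 < N w" using N0[of w] N_eq[of w] by linarith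
  have lower: "N w * norm x \<le> N x" for x
  proof (cases "x = 0")
    case False
    have "N x = N (norm x *\<^sub>R ((1 / norm x) *\<^sub>R x))" using False by simp
    also have "\<dots> = norm x * N ((1 / norm x) *\<^sub>R x)" unfolding N_scale[of "norm x"] by simp
    also have "\<dots> \<ge> norm x * N w" using False by (intro mult_left_mono w(2)) auto
    finally show ?thesis by (simp add: mult.commute)
  qed (use N0 in simp)
  show thesis by (rule that[OF w0 C lower upper])
qed

lemma dual_norm_upper:
  fixes N :: "'a::real_inner \<Rightarrow> real"
  assumes "0 < c" "\<And>x. c * norm x \<le> N x" "N y \<le> 1"
  shows "v \<bullet> y \<le> norm v / c"
proof -
  have "norm y \<le> 1 / c" using assms(1) assms(2)[of y] assms(3) by (simp add: field_simps)
  then have "norm v * norm y \<le> norm v * (1 / c)" by (intro mult_left_mono) auto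
  then show ?thesis using norm_cauchy_schwarz[of v y] by simp
qed

lemma dual_norm_bdd_above:
  fixes N :: "'a::real_inner \<Rightarrow> real"
  assumes "0 < c" "\<And>x. c * norm x \<le> N x"
  shows "bdd_above ((\<lambda>y. v \<bullet> y) ` {y. N y \<le> 1})"
  using dual_norm_upper[OF assms] by (intro bdd_aboveI2) auto

text \<open>
  Testing the supremum with v scaled to have N-norm at most 1.
\<close>

lemma dual_norm_lower_bound:
  fixes N :: "'a::real_inner \<Rightarrow> real"
  assumes c: "0 < c" "\<And>x. c * norm x \<le> N x" and C: "0 < C" "\<And>x. N x \<le> C * norm x"
  shows "norm v \<le> C * dual_norm N v"
proof -
  define y where "y = (if v = 0 then 0 else (1 / (C * norm v)) *\<^sub>R v)"
  have "N y \<le> 1" using C(1) C(2)[of y] by (auto simp: y_def split: if_splits)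
  then have "v \<bullet> y \<le> dual_norm N v"
    unfolding dual_norm_def by (intro cSUP_upper dual_norm_bdd_above[OF c]) simp
  moreover have "C * (v \<bullet> y) = norm v"
    using C(1) by (simp add: y_def power2_norm_eq_inner[symmetric] power2_eq_square)
  ultimately show ?thesis using C(1) by (metis mult_left_mono less_imp_le)
qed

lemma continuous_dual_norm:
  fixes N :: "'a::real_inner \<Rightarrow> real"
  assumes c: "0 < c" "\<And>x. c * norm x \<le> N x" and N0: "N 0 = 0"
  shows "continuous_on UNIV (dual_norm N)"
proof -
  have *: "dual_norm N v \<le> dual_norm N w + norm (v - w) / c" for v w
  proof -
    have "v \<bullet> y \<le> dual_norm N w + norm (v - w) / c" if "N y \<le> 1" for y
    proof -
      have "w \<bullet> y \<le> dual_norm N w"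
        unfolding dual_norm_def using that by (intro cSUP_upper dual_norm_bdd_above[OF c]) simp
      then show ?thesis using dual_norm_upper[OF c that, of "v - w"] by (simp add: inner_diff_left)
    qed
    moreover have "{y. N y \<le> 1} \<noteq> {}" using N0 by (auto intro!: exI[of _ 0])
    ultimately show ?thesis unfolding dual_norm_def[of N v] by (intro cSUP_least) auto
  qed
  have "(1 / c)-lipschitz_on UNIV (dual_norm N)"
  proof (rule lipschitz_onI)
    fix v w show "dist (dual_norm N v) (dual_norm N w) \<le> 1 / c * dist v w"
      using *[of v w] *[of w v] by (simp add: dist_norm norm_minus_commute abs_le_iff)
  qed (use c in simp)
  then show ?thesis by (rule lipschitz_on_continuous_on)
qed

lemma strongly_convex_on_euclidean:
  assumes "strongly_convex_on U N \<sigma> R" "0 < \<sigma>" "0 < c" "\<And>x. c * norm x \<le> N x"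
  shows "strongly_convex_on U norm (\<sigma> * c\<^sup>2) R"
  unfolding strongly_convex_on_def
proof (intro conjI ballI)
  show "convex U" using assms(1) by (simp add: strongly_convex_on_def)
  fix x y u assume *: "x \<in> U" "y \<in> U" "u \<in> {0..1::real}"
  then have "R ((1 - u) *\<^sub>R x + u *\<^sub>R y)
      \<le> (1 - u) * R x + u * R y - \<sigma> / 2 * u * (1 - u) * (N (x - y))\<^sup>2"
    using assms(1) by (simp add: strongly_convex_on_def)
  moreover have "\<sigma> / 2 * u * (1 - u) * (c * norm (x - y))\<^sup>2 \<le> \<sigma> / 2 * u * (1 - u) * (N (x - y))\<^sup>2"
    using * assms by (intro mult_left_mono power_mono) auto
  ultimately show "R ((1 - u) *\<^sub>R x + u *\<^sub>R y)
      \<le> (1 - u) * R x + u * R y - \<sigma> * c\<^sup>2 / 2 * u * (1 - u) * (norm (x - y))\<^sup>2"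
    by (simp add: power_mult_distrib mult_ac)
qed

section \<open>Minimizers and minimizing sequences\<close>

lemma opt_val_le:
  assumes "compact X" "continuous_on X f" "z \<in> X"
  shows "opt_val f X \<le> (f z :: real)"
  unfolding opt_val_def
  using compact_imp_bounded[OF compact_continuous_image[OF assms(2,1)]] assms(3)
  by (intro cINF_lower bounded_imp_bdd_below)

lemma opt_set_nonempty:
  fixes f :: "'a::topological_space \<Rightarrow> real"
  assumes "compact X" "continuous_on X f" "X \<noteq> {}"
  shows "opt_set f X \<noteq> {}"
proof -
  obtain p where p: "p \<in> X" "\<forall>y\<in>X. f p \<le> f y"
    using continuous_attains_inf[OF assms(1,3,2)] by blast
  then have "f p \<le> opt_val f X" unfolding opt_val_def using assms(3) by (intro cINF_greatest) auto
  then have "p \<in> opt_set f X" using p(1) opt_val_le[OF assms(1,2) p(1)] by (simp add: opt_set_def)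
  then show ?thesis by blast
qed

lemma closed_opt_set:
  fixes f :: "'a::t2_space \<Rightarrow> real"
  assumes "compact X" "continuous_on X f"
  shows "closed (opt_set f X)"
proof -
  have "opt_set f X = X \<inter> f -` {opt_val f X}" by (auto simp: opt_set_def)
  then show ?thesis
    using continuous_on_closed_vimage[OF compact_imp_closed[OF assms(1)], of f] assms(2)
    by (simp add: Int_commute)
qed

text \<open>
  If the gaps f (x n) - f* stayed above a positive number eventually, the weighted gaps would dominate
  a divergent series. So the gaps are small at arbitrarily late indices, and compactness of X extracts a
  limit, at which f attains f* by continuity.
\<close>

lemma optimal_cluster_point:
  fixes x :: "nat \<Rightarrow> 'a::metric_space"
  assumes X: "compact X" and f: "continuous_on X f" and x: "\<And>n. x n \<in> X"
    and a: "\<And>n. 0 < a n" "\<not> summable a"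
    and gap: "summable (\<lambda>n. a n * (f (x n) - opt_val f X))"
  obtains p r where "p \<in> opt_set f X" "filterlim r at_top sequentially" "(\<lambda>k. x (r k)) \<longlonglongrightarrow> p"
proof -
  have gap0: "0 \<le> f (x n) - opt_val f X" for n using opt_val_le[OF X f x] by simp
  have "\<exists>n\<ge>m. f (x n) - opt_val f X < \<epsilon>" if "0 < \<epsilon>" for \<epsilon> :: real and m
  proof (rule ccontr)
    assume "\<not> (\<exists>n\<ge>m. f (x n) - opt_val f X < \<epsilon>)"
    then have ge: "\<epsilon> \<le> f (x n) - opt_val f X" if "n \<ge> m" for n using that by force
    have "norm (\<epsilon> * a n) \<le> a n * (f (x n) - opt_val f X)" if "n \<ge> m" for n
      using mult_left_mono[OF ge[OF that], of "a n"] a(1)[of n] \<open>0 < \<epsilon>\<close> by (simp add: mult.commute)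
    then have "summable (\<lambda>n. \<epsilon> * a n)"
      by (intro summable_comparison_test[OF _ gap]) blast
    then show False using a(2) \<open>0 < \<epsilon>\<close> by simp
  qed
  then have "\<forall>k. \<exists>n\<ge>k. f (x n) - opt_val f X < inverse (real (Suc k))" by simp
  \<comment> \<open>q need not be monotone; q k \<ge> k alone makes the final index sequence tend to infinity.\<close>
  then obtain q where q: "\<And>k. k \<le> q k" "\<And>k. f (x (q k)) - opt_val f X < inverse (real (Suc k))"
    by metis
  obtain p r where p: "p \<in> X" and r: "strict_mono r" "((\<lambda>k. x (q k)) \<circ> r) \<longlonglongrightarrow> p"
    using X x unfolding compact_def by metis
  have qr: "filterlim (q \<circ> r) at_top sequentially"
  proof (rule filterlim_at_top_mono[OF filterlim_subseq[OF r(1)]])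
    show "\<forall>\<^sub>F k in sequentially. r k \<le> (q \<circ> r) k" using q(1) by simp
  qed
  have lim: "(\<lambda>k. x (q (r k))) \<longlonglongrightarrow> p" using r(2) by (simp add: o_def)
  have "(\<lambda>k. f (x (q (r k))) - opt_val f X) \<longlonglongrightarrow> f p - opt_val f X"
    using continuous_on_tendsto_compose[OF f lim p] x by (intro tendsto_intros) auto
  moreover have "(\<lambda>k. f (x (q (r k))) - opt_val f X) \<longlonglongrightarrow> 0"
  proof (rule tendsto_sandwich[OF _ _ tendsto_const])
    show "(\<lambda>k. inverse (real (Suc (r k)))) \<longlonglongrightarrow> 0"
      using filterlim_compose[OF LIMSEQ_inverse_real_of_nat filterlim_subseq[OF r(1)]] .
    show "\<forall>\<^sub>F k in sequentially. f (x (q (r k))) - opt_val f X \<le> inverse (real (Suc (r k)))"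
      using q(2) by (intro always_eventually allI less_imp_le)
  qed (use gap0 in simp)
  ultimately have "f p = opt_val f X" using LIMSEQ_unique by fastforce
  then show thesis using that[of p "q \<circ> r"] p qr lim by (simp add: opt_set_def o_def)
qed

section \<open>Histories and conditional expectations\<close>

lemma space_hist [simp]: "space (hist M x t) = space M"
  unfolding hist_def by (rule space_measure_of) auto

lemma sets_hist:
  "sets (hist M x t) = sigma_sets (space M) (\<Union>i\<in>{1..t}. {x i -` A \<inter> space M | A. A \<in> sets borel})"
  unfolding hist_def by (rule sets_measure_of) auto

lemma subalgebra_hist:
  assumes "\<And>i. 1 \<le> i \<Longrightarrow> i \<le> t \<Longrightarrow> x i \<in> borel_measurable M"
  shows "subalgebra M (hist M x t)"
proof -
  have "(\<Union>i\<in>{1..t}. {x i -` A \<inter> space M | A. A \<in> sets borel}) \<subseteq> sets M"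
    using assms by (auto intro: measurable_sets)
  then show ?thesis by (simp add: subalgebra_def sets_hist sets.sigma_sets_subset)
qed

lemma subalgebra_hist_Suc: "subalgebra (hist M x (Suc t)) (hist M x t)"
  unfolding subalgebra_def sets_hist by (intro conjI sigma_sets_mono' UN_mono) auto

lemma measurable_hist:
  assumes "1 \<le> t"
  shows "x t \<in> borel_measurable (hist M x t)"
proof (rule measurableI)
  fix A :: "'b set" assume "A \<in> sets borel"
  then have "x t -` A \<inter> space M \<in> (\<Union>i\<in>{1..t}. {x i -` A \<inter> space M | A. A \<in> sets borel})"
    using assms by (intro UN_I[of t]) auto
  then show "x t -` A \<inter> space (hist M x t) \<in> sets (hist M x t)"
    unfolding sets_hist by simp
qed simp

text \<open>
  The extended conditional expectation carries the information that q is integrable, which the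
  real-valued one by itself cannot express.
\<close>

lemma (in sigma_finite_subalgebra) real_cond_exp_le_of_nn_cond_exp_le:
  assumes q: "q \<in> borel_measurable M" "\<And>\<omega>. 0 \<le> q \<omega>" and "0 \<le> k" and "prob_space M"
    and le: "AE \<omega> in M. nn_cond_exp M F (\<lambda>\<omega>. ennreal (q \<omega>)) \<omega> \<le> ennreal k"
  shows "integrable M q" "AE \<omega> in M. real_cond_exp M F q \<omega> \<le> k"
proof -
  interpret prob_space M by fact
  have "(\<integral>\<^sup>+ \<omega>. ennreal (q \<omega>) \<partial>M) = (\<integral>\<^sup>+ \<omega>. nn_cond_exp M F (\<lambda>\<omega>. ennreal (q \<omega>)) \<omega> \<partial>M)"
    using nn_cond_exp_intg[of "\<lambda>_. 1" "\<lambda>\<omega>. ennreal (q \<omega>)"] q(1) by simp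
  also have "\<dots> \<le> (\<integral>\<^sup>+ \<omega>. ennreal k \<partial>M)" by (rule nn_integral_mono_AE[OF le])
  also have "\<dots> < \<infinity>" by (simp add: emeasure_space_1)
  finally show "integrable M q" using q by (intro integrableI_nonneg) auto
  have "AE \<omega> in M. ennreal \<bar>real_cond_exp M F q \<omega>\<bar> \<le> nn_cond_exp M F (\<lambda>\<omega>. ennreal \<bar>q \<omega>\<bar>) \<omega>"
    by (rule real_cond_exp_abs[OF q(1)])
  with le show "AE \<omega> in M. real_cond_exp M F q \<omega> \<le> k"
  proof eventually_elim
    case (elim \<omega>)
    have "ennreal \<bar>real_cond_exp M F q \<omega>\<bar> \<le> ennreal k"
      using elim q(2) by (simp add: order_trans)
    then show ?case using \<open>0 \<le> k\<close> by (simp add: ennreal_le_iff)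
  qed
qed

text \<open>
  Pulling out the known factor w, coordinate by coordinate.
\<close>

lemma (in sigma_finite_subalgebra) vec_cond_exp_inner:
  fixes v w :: "'a \<Rightarrow> real ^ 'n"
  assumes v: "v \<in> borel_measurable M" "integrable M (\<lambda>\<omega>. norm (v \<omega>))"
    and w: "w \<in> borel_measurable F" "\<And>\<omega>. \<omega> \<in> space M \<Longrightarrow> norm (w \<omega>) \<le> L"
  shows "integrable M (\<lambda>\<omega>. v \<omega> \<bullet> w \<omega>)"
    "AE \<omega> in M. real_cond_exp M F (\<lambda>\<omega>. v \<omega> \<bullet> w \<omega>) \<omega> = vec_cond_exp M F v \<omega> \<bullet> w \<omega>"
proof -
  have [measurable]: "v \<in> borel_measurable M" "w \<in> borel_measurable F" "w \<in> borel_measurable M"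
    using v w measurable_from_subalg[OF subalg] by auto
  have nth: "(\<lambda>y :: real ^ 'n. y $ i) \<in> borel_measurable borel" for i
    by (intro borel_measurable_continuous_onI continuous_intros)
  have vi [measurable]: "(\<lambda>\<omega>. v \<omega> $ i) \<in> borel_measurable M" for i
    by (rule measurable_compose[OF _ nth]) simp
  have wi [measurable]: "(\<lambda>\<omega>. w \<omega> $ i) \<in> borel_measurable F" for i
    by (rule measurable_compose[OF _ nth]) simp
  have wiM [measurable]: "(\<lambda>\<omega>. w \<omega> $ i) \<in> borel_measurable M" for i
    by (rule measurable_compose[OF _ nth]) simp
  have int: "integrable M (\<lambda>\<omega>. w \<omega> $ i * v \<omega> $ i)" for i
  proof (rule Bochner_Integration.integrable_bound)
    show "integrable M (\<lambda>\<omega>. L * norm (v \<omega>))" using v by simp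
    show "AE \<omega> in M. norm (w \<omega> $ i * v \<omega> $ i) \<le> norm (L * norm (v \<omega>))"
      using AE_space
    proof eventually_elim
      case (elim \<omega>)
      have "\<bar>w \<omega> $ i\<bar> \<le> L" "0 \<le> L"
        using component_le_norm_cart[of "w \<omega>" i] w(2)[OF elim] norm_ge_zero[of "w \<omega>"] by linarith+
      then show ?case
        using component_le_norm_cart[of "v \<omega>" i] by (auto simp: abs_mult intro!: mult_mono)
    qed
  qed measurable
  have inner: "v \<omega> \<bullet> w \<omega> = (\<Sum>i\<in>UNIV. w \<omega> $ i * v \<omega> $ i)" for \<omega>
    by (simp add: inner_vec_def mult.commute)
  show "integrable M (\<lambda>\<omega>. v \<omega> \<bullet> w \<omega>)" unfolding inner using int by simp
  have "AE \<omega> in M. \<forall>i\<in>UNIV. real_cond_exp M F (\<lambda>\<omega>. w \<omega> $ i * v \<omega> $ i) \<omega> = w \<omega> $ i * real_cond_exp M F (\<lambda>\<omega>. v \<omega> $ i) \<omega>"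
    by (intro AE_finite_allI real_cond_exp_mult int) auto
  moreover have "AE \<omega> in M. real_cond_exp M F (\<lambda>\<omega>. \<Sum>i\<in>UNIV. w \<omega> $ i * v \<omega> $ i) \<omega>
      = (\<Sum>i\<in>UNIV. real_cond_exp M F (\<lambda>\<omega>. w \<omega> $ i * v \<omega> $ i) \<omega>)"
    by (rule real_cond_exp_sum) (rule int)
  ultimately show "AE \<omega> in M. real_cond_exp M F (\<lambda>\<omega>. v \<omega> \<bullet> w \<omega>) \<omega> = vec_cond_exp M F v \<omega> \<bullet> w \<omega>"
    unfolding inner by eventually_elim (simp add: vec_cond_exp_def inner_vec_def mult.commute)
qed

section \<open>Convergence of stochastic mirror descent\<close>

text \<open>
  The conditional version of mirror_step_bregman. Everything in sight is integrable because X is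
  compact and v is square integrable.
\<close>

lemma mirror_step_conditional_drift:
  fixes X U :: "(real ^ 'n) set" and v x y :: "'w \<Rightarrow> real ^ 'n"
  assumes "mirror_map X U R s" and M: "prob_space M" and F: "subalgebra M F"
    and x: "x \<in> borel_measurable F" "\<And>\<omega>. \<omega> \<in> space M \<Longrightarrow> x \<omega> \<in> X"
    and v: "v \<in> borel_measurable M" "integrable M (\<lambda>\<omega>. (norm (v \<omega>))\<^sup>2)"
      "AE \<omega> in M. real_cond_exp M F (\<lambda>\<omega>. (norm (v \<omega>))\<^sup>2) \<omega> \<le> k"
    and a: "0 < a" and z: "z \<in> X"
    and y: "\<And>\<omega>. \<omega> \<in> space M \<Longrightarrow>
      mirror_map.variational_solution X R (gradient R (x \<omega>) - a *\<^sub>R v \<omega>) (y \<omega>)"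
  shows "AE \<omega> in M. real_cond_exp M F (\<lambda>\<omega>. bregman R z (y \<omega>)) \<omega>
    \<le> bregman R z (x \<omega>) + a * (vec_cond_exp M F v \<omega> \<bullet> (z - x \<omega>)) + a\<^sup>2 / (2 * s) * k"
proof -
  interpret mirror_map X U R s by fact
  interpret prob_space M by fact
  interpret finite_measure_subalgebra M F using F by unfold_locales
  have spF: "space F = space M" using F by (simp add: subalgebra_def)
  have xM: "x \<in> borel_measurable M" by (rule measurable_from_subalg[OF F x(1)])
  have yM: "y \<in> borel_measurable M" by (rule mirror_step_measurable[OF xM x(2) v(1) y])
  have yX: "y \<omega> \<in> X" if "\<omega> \<in> space M" for \<omega> using y[OF that] by (simp add: variational_solution_def)
  obtain G where G: "0 < G" "\<And>y. y \<in> X \<Longrightarrow> norm (gradient R y) \<le> G" using gradient_bounded by blast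
  obtain L where L: "\<And>p. p \<in> X \<Longrightarrow> norm p \<le> L"
    using compact_imp_bounded[OF X_compact] bounded_iff by blast
  have zp: "norm (z - p) \<le> 2 * L" if "p \<in> X" for p
    using norm_triangle_ineq4[of z p] L[OF z] L[OF that] by linarith
  have breg: "\<bar>bregman R z p\<bar> \<le> 2 * G * (2 * L)" if "p \<in> X" for p
  proof -
    have "bregman R z p \<le> 2 * G * norm (z - p)" using bregman_bounded[OF G(2)] z that by blast
    also have "\<dots> \<le> 2 * G * (2 * L)" using zp[OF that] G(1) by (intro mult_left_mono) auto
    finally show ?thesis using bregman_nonneg z that XU by (simp add: subset_iff)
  qed
  have XU': "\<And>\<omega>. \<omega> \<in> space M \<Longrightarrow> x \<omega> \<in> U" "\<And>\<omega>. \<omega> \<in> space M \<Longrightarrow> y \<omega> \<in> U"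
    using x(2) yX XU by auto
  have Iy: "integrable M (\<lambda>\<omega>. bregman R z (y \<omega>))"
    by (rule integrable_bounded_real[OF bregman_measurable[OF yM XU'(2)]]) (use breg yX in auto)
  have Ix: "integrable M (\<lambda>\<omega>. bregman R z (x \<omega>))"
    by (rule integrable_bounded_real[OF bregman_measurable[OF xM XU'(1)]]) (use breg x(2) in auto)
  have nv: "integrable M (\<lambda>\<omega>. norm (v \<omega>))"
  proof (rule Bochner_Integration.integrable_bound)
    show "integrable M (\<lambda>\<omega>. 1 + (norm (v \<omega>))\<^sup>2)" using v(2) by simp
    have "norm (v \<omega>) \<le> 1 + (norm (v \<omega>))\<^sup>2" for \<omega>
      using self_le_power[of "norm (v \<omega>)" 2] zero_le_power2[of "norm (v \<omega>)"] by linarith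
    then show "AE \<omega> in M. norm (norm (v \<omega>)) \<le> norm (1 + (norm (v \<omega>))\<^sup>2)" by (simp add: abs_of_nonneg)
  qed (use v(1) in measurable)
  have w: "(\<lambda>\<omega>. z - x \<omega>) \<in> borel_measurable F" using x(1) by measurable
  have vw: "integrable M (\<lambda>\<omega>. v \<omega> \<bullet> (z - x \<omega>))"
    "AE \<omega> in M. real_cond_exp M F (\<lambda>\<omega>. v \<omega> \<bullet> (z - x \<omega>)) \<omega> = vec_cond_exp M F v \<omega> \<bullet> (z - x \<omega>)"
    using vec_cond_exp_inner[OF v(1) nv w zp[OF x(2)]] by auto
  define p q where "p = (\<lambda>\<omega>. a * (v \<omega> \<bullet> (z - x \<omega>)))" and "q = (\<lambda>\<omega>. a\<^sup>2 / (2 * s) * (norm (v \<omega>))\<^sup>2)"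
  have I: "integrable M p" "integrable M q" unfolding p_def q_def using vw(1) v(2) by auto
  have "AE \<omega> in M. real_cond_exp M F (\<lambda>\<omega>. bregman R z (y \<omega>)) \<omega>
      \<le> real_cond_exp M F (\<lambda>\<omega>. (bregman R z (x \<omega>) + p \<omega>) + q \<omega>) \<omega>"
  proof (rule real_cond_exp_mono[OF _ Iy])
    show "integrable M (\<lambda>\<omega>. (bregman R z (x \<omega>) + p \<omega>) + q \<omega>)" using Ix I by simp
    show "AE \<omega> in M. bregman R z (y \<omega>) \<le> (bregman R z (x \<omega>) + p \<omega>) + q \<omega>"
      using AE_space
    proof eventually_elim
      case (elim \<omega>)
      show ?case using mirror_step_bregman[OF a x(2)[OF elim] z y[OF elim]] by (simp add: p_def q_def)
    qed
  qed
  moreover have "AE \<omega> in M. real_cond_exp M F (\<lambda>\<omega>. (bregman R z (x \<omega>) + p \<omega>) + q \<omega>) \<omega>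
      = real_cond_exp M F (\<lambda>\<omega>. bregman R z (x \<omega>) + p \<omega>) \<omega> + real_cond_exp M F q \<omega>"
    using Ix I by (intro real_cond_exp_add) auto
  moreover have "AE \<omega> in M. real_cond_exp M F (\<lambda>\<omega>. bregman R z (x \<omega>) + p \<omega>) \<omega>
      = real_cond_exp M F (\<lambda>\<omega>. bregman R z (x \<omega>)) \<omega> + real_cond_exp M F p \<omega>"
    using Ix I by (intro real_cond_exp_add) auto
  moreover have "AE \<omega> in M. real_cond_exp M F (\<lambda>\<omega>. bregman R z (x \<omega>)) \<omega> = bregman R z (x \<omega>)"
    using bregman_measurable[OF x(1)] XU'(1) spF by (intro real_cond_exp_F_meas Ix) auto
  moreover have "AE \<omega> in M. real_cond_exp M F p \<omega> = a * real_cond_exp M F (\<lambda>\<omega>. v \<omega> \<bullet> (z - x \<omega>)) \<omega>"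
    unfolding p_def by (rule real_cond_exp_cmult[OF vw(1)])
  moreover have "AE \<omega> in M. real_cond_exp M F q \<omega> = a\<^sup>2 / (2 * s) * real_cond_exp M F (\<lambda>\<omega>. (norm (v \<omega>))\<^sup>2) \<omega>"
    unfolding q_def by (rule real_cond_exp_cmult[OF v(2)])
  ultimately show ?thesis using vw(2) v(3)
  proof eventually_elim
    case (elim \<omega>)
    have "a\<^sup>2 / (2 * s) * real_cond_exp M F (\<lambda>\<omega>. (norm (v \<omega>))\<^sup>2) \<omega> \<le> a\<^sup>2 / (2 * s) * k"
      using elim s_pos by (intro mult_left_mono) auto
    then show ?case using elim by simp
  qed
qed

theorem theorem2:
  fixes M :: "'w measure"
    and N :: "real ^ 'n \<Rightarrow> real"
    and X U :: "(real ^ 'n) set"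
    and f R :: "real ^ 'n \<Rightarrow> real"
    and \<sigma> \<nu> :: real
    and \<alpha> :: "nat \<Rightarrow> real"
    and x gn g b :: "nat \<Rightarrow> 'w \<Rightarrow> real ^ 'n"
  assumes "prob_space M"
    and "is_norm N"
    and "X \<noteq> {}" and "convex X" and "compact X"
    and "convex_on UNIV f" and "continuous_on UNIV f"
    and "open U" and "X \<subseteq> U"
    and "\<sigma> > 0" and "strongly_convex_on U N \<sigma> R"
    and "\<And>y. y \<in> U \<Longrightarrow> R differentiable (at y)"
    and "\<And>t. t \<ge> 1 \<Longrightarrow> \<alpha> t > 0"
    and "x 1 \<in> borel_measurable M"
    and "\<And>\<omega>. \<omega> \<in> space M \<Longrightarrow> x 1 \<omega> \<in> X"
    and "\<And>t. t \<ge> 1 \<Longrightarrow> gn t \<in> borel_measurable M"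
    and "\<And>t \<omega>. t \<ge> 1 \<Longrightarrow> \<omega> \<in> space M \<Longrightarrow>
           is_arg_min (\<lambda>z. gn t \<omega> \<bullet> (z - x t \<omega>) + 1 / \<alpha> t * bregman R z (x t \<omega>))
                      (\<lambda>z. z \<in> X) (x (t + 1) \<omega>)"
    and "assumption_A1 M N f x gn g b \<nu>"
    and "assumption_A2 \<alpha>"
    and "assumption_A3 M N \<alpha> b"
  shows "\<exists>xs. xs \<in> borel_measurable M \<and>
              (\<forall>\<omega>\<in>space M. xs \<omega> \<in> opt_set f X) \<and>
              (AE \<omega> in M. (\<lambda>t. x t \<omega>) \<longlonglongrightarrow> xs \<omega>)"
proof -
  interpret prob_space M by fact
  obtain c C where c: "0 < c" "\<And>x. c * norm x \<le> N x" and C: "0 < C" "\<And>x. N x \<le> C * norm x"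
    by (rule is_norm_bounds[OF assms(2)]) (rule that)
  have N0: "N 0 = 0" using assms(2) by (simp add: is_norm_def)
  \<comment> \<open>The modulus of strong convexity with respect to the Euclidean norm.\<close>
  define s where "s = \<sigma> * c\<^sup>2"
  have mm: "mirror_map X U R s"
  proof
    show "0 < s" using assms(10) c(1) by (simp add: s_def)
    show "strongly_convex_on U norm s R"
      unfolding s_def by (rule strongly_convex_on_euclidean[OF assms(11,10) c])
  qed (fact assms)+
  then interpret mirror_map X U R s .
  note step = assms(17) and \<alpha>_pos = assms(13)
  have xX: "x t \<omega> \<in> X" if "1 \<le> t" "\<omega> \<in> space M" for t \<omega>
  proof (cases "t = 1")
    case False
    define t' where "t' = t - 1"
    have "t = t' + 1" "1 \<le> t'" using False \<open>1 \<le> t\<close> by (simp_all add: t'_def)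
    then show ?thesis using step[of t' \<omega>] that by (simp add: is_arg_min_def)
  qed (use assms(15) that in simp)
  have vs: "variational_solution (gradient R (x t \<omega>) - \<alpha> t *\<^sub>R gn t \<omega>) (x (Suc t) \<omega>)"
    if "1 \<le> t" "\<omega> \<in> space M" for t \<omega>
    using mirror_step_variational[OF \<alpha>_pos[OF that(1)] xX[OF that] step[OF that]] by simp
  have xM: "x t \<in> borel_measurable M" if "1 \<le> t" for t
    using that
  proof (induction t rule: dec_induct)
    case (step t)
    then show ?case using mirror_step_measurable[OF _ xX assms(16) vs] by blast
  qed (fact assms(14))
  \<comment> \<open>Time is shifted by one: index n stands for the iterate x (n + 1).\<close>
  define F where "F = (\<lambda>n. hist M x (Suc n))"
  have sub: "subalgebra M (F n)" for n unfolding F_def by (rule subalgebra_hist) (use xM in auto)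
  have mono: "subalgebra (F (Suc n)) (F n)" for n unfolding F_def by (rule subalgebra_hist_Suc)
  have xF: "x (Suc n) \<in> borel_measurable (F n)" for n unfolding F_def by (rule measurable_hist) simp
  have spF: "space (F n) = space M" for n by (simp add: F_def)
  have A1: "AE \<omega> in M. g (Suc n) \<omega> \<in> subdifferential f (x (Suc n) \<omega>)"
    "b (Suc n) \<in> borel_measurable (F n)"
    "AE \<omega> in M. vec_cond_exp M (F n) (gn (Suc n)) \<omega> = g (Suc n) \<omega> + b (Suc n) \<omega>"
    "AE \<omega> in M. nn_cond_exp M (F n) (\<lambda>\<omega>. ennreal ((dual_norm N (gn (Suc n) \<omega>))\<^sup>2)) \<omega> \<le> ennreal (\<nu>\<^sup>2)" for n
    using assms(18) unfolding assumption_A1_def F_def by auto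
  have moment: "integrable M (\<lambda>\<omega>. (norm (gn (Suc n) \<omega>))\<^sup>2)"
    "AE \<omega> in M. real_cond_exp M (F n) (\<lambda>\<omega>. (norm (gn (Suc n) \<omega>))\<^sup>2) \<omega> \<le> C\<^sup>2 * \<nu>\<^sup>2" for n
  proof -
    interpret finite_measure_subalgebra M "F n" using sub by unfold_locales
    have [measurable]: "gn (Suc n) \<in> borel_measurable M" by (rule assms(16)) simp
    have "(\<lambda>\<omega>. dual_norm N (gn (Suc n) \<omega>)) \<in> borel_measurable M"
      by (rule measurable_compose[OF _ borel_measurable_continuous_onI[OF continuous_dual_norm[OF c N0]]]) simp
    then have qM: "(\<lambda>\<omega>. (dual_norm N (gn (Suc n) \<omega>))\<^sup>2) \<in> borel_measurable M" by measurable
    have q: "integrable M (\<lambda>\<omega>. (dual_norm N (gn (Suc n) \<omega>))\<^sup>2)"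
      "AE \<omega> in M. real_cond_exp M (F n) (\<lambda>\<omega>. (dual_norm N (gn (Suc n) \<omega>))\<^sup>2) \<omega> \<le> \<nu>\<^sup>2"
      using real_cond_exp_le_of_nn_cond_exp_le[OF qM _ _ assms(1) A1(4)[of n]] by auto
    have le: "(norm (gn (Suc n) \<omega>))\<^sup>2 \<le> C\<^sup>2 * (dual_norm N (gn (Suc n) \<omega>))\<^sup>2" for \<omega>
      using power_mono[OF dual_norm_lower_bound[OF c C, of "gn (Suc n) \<omega>"] norm_ge_zero, of 2]
      by (simp add: power_mult_distrib)
    have Cq: "integrable M (\<lambda>\<omega>. C\<^sup>2 * (dual_norm N (gn (Suc n) \<omega>))\<^sup>2)" using q(1) by simp
    show I: "integrable M (\<lambda>\<omega>. (norm (gn (Suc n) \<omega>))\<^sup>2)"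
      by (rule Bochner_Integration.integrable_bound[OF Cq]) (use le in auto)
    have "AE \<omega> in M. real_cond_exp M (F n) (\<lambda>\<omega>. (norm (gn (Suc n) \<omega>))\<^sup>2) \<omega>
        \<le> real_cond_exp M (F n) (\<lambda>\<omega>. C\<^sup>2 * (dual_norm N (gn (Suc n) \<omega>))\<^sup>2) \<omega>"
      by (rule real_cond_exp_mono[OF _ I Cq]) (use le in simp)
    then show "AE \<omega> in M. real_cond_exp M (F n) (\<lambda>\<omega>. (norm (gn (Suc n) \<omega>))\<^sup>2) \<omega> \<le> C\<^sup>2 * \<nu>\<^sup>2"
      using q(2) real_cond_exp_cmult[OF q(1), of "C\<^sup>2"]
    proof eventually_elim
      case (elim \<omega>)
      have "C\<^sup>2 * real_cond_exp M (F n) (\<lambda>\<omega>. (dual_norm N (gn (Suc n) \<omega>))\<^sup>2) \<omega> \<le> C\<^sup>2 * \<nu>\<^sup>2"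
        using elim by (intro mult_left_mono) auto
      then show ?case using elim by simp
    qed
  qed
  obtain G where G: "0 < G" "\<And>y. y \<in> X \<Longrightarrow> norm (gradient R y) \<le> G" using gradient_bounded by blast
  obtain L where L: "\<And>p. p \<in> X \<Longrightarrow> norm p \<le> L"
    using compact_imp_bounded[OF X_compact] bounded_iff by blast
  have diam: "norm (z - p) \<le> 2 * L" if "z \<in> X" "p \<in> X" for z p
    using norm_triangle_ineq4[of z p] L that by (smt (verit))
  have fX: "continuous_on X f" using assms(7) continuous_on_subset by blast
  note opt_le = opt_val_le[OF X_compact fX]
  define a where "a = (\<lambda>n. \<alpha> (Suc n))"
  have a_pos: "0 < a n" for n unfolding a_def by (rule \<alpha>_pos) simp
  \<comment> \<open>The errors of one step: the bias paired with z - x, and the second moment of the noisy subgradient.\<close>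
  define e where "e = (\<lambda>n \<omega>. a n * (norm (b (Suc n) \<omega>) * (2 * L)) + (a n)\<^sup>2 / (2 * s) * (C\<^sup>2 * \<nu>\<^sup>2))"
  define u where "u = (\<lambda>n \<omega>. a n * (f (x (Suc n) \<omega>) - opt_val f X))"
  have e_sum: "AE \<omega> in M. summable (\<lambda>n. e n \<omega>)"
  proof -
    have sq: "summable (\<lambda>n. (a n)\<^sup>2)" using assms(19) by (simp add: assumption_A2_def a_def)
    have "AE \<omega> in M. summable (\<lambda>n. a n * dual_norm N (b (Suc n) \<omega>))"
      using assms(20) by (simp add: assumption_A3_def a_def)
    then show ?thesis
    proof eventually_elim
      case (elim \<omega>)
      have "summable (\<lambda>n. a n * norm (b (Suc n) \<omega>))"
      proof (rule summable_comparison_test[OF _ summable_mult[OF elim, of C]], intro exI allI impI)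
        fix n
        show "norm (a n * norm (b (Suc n) \<omega>)) \<le> C * (a n * dual_norm N (b (Suc n) \<omega>))"
          using mult_left_mono[OF dual_norm_lower_bound[OF c C, of "b (Suc n) \<omega>"], of "a n"] a_pos[of n]
          by (simp add: mult_ac)
      qed
      from summable_mult2[OF this, of "2 * L"] summable_mult2[OF sq, of "1 / (2 * s) * (C\<^sup>2 * \<nu>\<^sup>2)"]
      have "summable (\<lambda>n. a n * norm (b (Suc n) \<omega>) * (2 * L) + (a n)\<^sup>2 * (1 / (2 * s) * (C\<^sup>2 * \<nu>\<^sup>2)))"
        by (rule summable_add)
      then show ?case by (simp add: e_def mult.assoc)
    qed
  qed
  have L0: "0 \<le> L" using X_ne L norm_ge_zero by (meson ex_in_conv order_trans)
  have conv: "AE \<omega> in M. convergent (\<lambda>n. bregman R z (x (Suc n) \<omega>)) \<and> summable (\<lambda>n. u n \<omega>)"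
    if z: "z \<in> opt_set f X" for z
  proof -
    have zX: "z \<in> X" and fz: "f z = opt_val f X" using z by (auto simp: opt_set_def)
    show ?thesis
    proof (rule bounded_robbins_siegmund[where F = F and e = e and C = "2 * G * (2 * L)", OF sub mono])
      show "(\<lambda>\<omega>. bregman R z (x (Suc n) \<omega>)) \<in> borel_measurable (F n)" for n
        by (rule bregman_measurable[OF xF]) (use xX XU spF in \<open>auto simp: subset_iff\<close>)
      show "0 \<le> bregman R z (x (Suc n) \<omega>) \<and> bregman R z (x (Suc n) \<omega>) \<le> 2 * G * (2 * L)"
        if "\<omega> \<in> space M" for n \<omega>
      proof
        have p: "x (Suc n) \<omega> \<in> X" using xX that by simp
        show "0 \<le> bregman R z (x (Suc n) \<omega>)" using bregman_nonneg zX p XU by blast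
        have "bregman R z (x (Suc n) \<omega>) \<le> 2 * G * norm (z - x (Suc n) \<omega>)"
          using bregman_bounded[OF G(2)] zX p by blast
        also have "\<dots> \<le> 2 * G * (2 * L)" using diam[OF zX p] G(1) by (intro mult_left_mono) auto
        finally show "bregman R z (x (Suc n) \<omega>) \<le> 2 * G * (2 * L)" .
      qed
      show "e n \<in> borel_measurable (F n)" for n unfolding e_def using A1(2)[of n] by measurable
      show "0 \<le> e n \<omega>" for n \<omega> unfolding e_def using a_pos[of n] s_pos L0 by simp
      show "0 \<le> u n \<omega>" if "\<omega> \<in> space M" for n \<omega>
        unfolding u_def using a_pos[of n] opt_le[OF xX[OF _ that]] by simp
      show "AE \<omega> in M. summable (\<lambda>n. e n \<omega>)" by (rule e_sum)
      fix n
      have "AE \<omega> in M. real_cond_exp M (F n) (\<lambda>\<omega>. bregman R z (x (Suc (Suc n)) \<omega>)) \<omega>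
          \<le> bregman R z (x (Suc n) \<omega>) + a n * (vec_cond_exp M (F n) (gn (Suc n)) \<omega> \<bullet> (z - x (Suc n) \<omega>))
            + (a n)\<^sup>2 / (2 * s) * (C\<^sup>2 * \<nu>\<^sup>2)"
        by (rule mirror_step_conditional_drift[OF mm assms(1) sub xF _ _ moment a_pos zX])
           (use xX vs assms(16) in \<open>auto simp: a_def\<close>)
      then show "AE \<omega> in M. real_cond_exp M (F n) (\<lambda>\<omega>. bregman R z (x (Suc (Suc n)) \<omega>)) \<omega>
          \<le> bregman R z (x (Suc n) \<omega>) - u n \<omega> + e n \<omega>"
        using A1(1)[of n] A1(3)[of n] AE_space
      proof eventually_elim
        case (elim \<omega>)
        have p: "x (Suc n) \<omega> \<in> X" using xX elim(4) by simp
        have "g (Suc n) \<omega> \<bullet> (z - x (Suc n) \<omega>) \<le> opt_val f X - f (x (Suc n) \<omega>)"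
          using elim(2) fz by (auto simp: subdifferential_def dest!: spec[of _ z])
        moreover have "b (Suc n) \<omega> \<bullet> (z - x (Suc n) \<omega>) \<le> norm (b (Suc n) \<omega>) * (2 * L)"
          using norm_cauchy_schwarz diam[OF zX p] by (meson mult_left_mono norm_ge_zero order_trans)
        ultimately have "vec_cond_exp M (F n) (gn (Suc n)) \<omega> \<bullet> (z - x (Suc n) \<omega>)
            \<le> (opt_val f X - f (x (Suc n) \<omega>)) + norm (b (Suc n) \<omega>) * (2 * L)"
          unfolding elim(3) inner_add_left by linarith
        from mult_left_mono[OF this, of "a n"] show ?case
          using elim(1) a_pos[of n] unfolding e_def u_def by (simp add: algebra_simps)
      qed
    qed
  qed
  \<comment> \<open>Countability keeps the union of the exceptional sets null.\<close>
  obtain Q where Q: "countable Q" "Q \<subseteq> opt_set f X" "opt_set f X \<subseteq> closure Q"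
    by (rule separable)
  obtain x0 where x0: "x0 \<in> opt_set f X" using opt_set_nonempty[OF X_compact fX X_ne] by blast
  have not_summable: "\<not> summable a"
  proof
    assume "summable a"
    then have "convergent (\<lambda>n. \<Sum>k<n. a k)" by (simp add: summable_iff_convergent)
    moreover have "(\<Sum>k<n. a k) = (\<Sum>t=1..n. \<alpha> t)" for n
      unfolding a_def by (rule sum.reindex_bij_witness[of _ "\<lambda>t. t - 1" Suc]) auto
    moreover have "filterlim (\<lambda>n. \<Sum>t=1..n. \<alpha> t) at_top sequentially"
      using assms(19) by (simp add: assumption_A2_def)
    ultimately show False
      using not_tendsto_and_filterlim_at_infinity[OF sequentially_bot]
        filterlim_at_top_imp_at_infinity by (auto simp: convergent_def)
  qed
  have limit: "AE \<omega> in M. \<exists>p\<in>opt_set f X. (\<lambda>t. x t \<omega>) \<longlonglongrightarrow> p"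
  proof -
    have "AE \<omega> in M. \<forall>z\<in>Q. convergent (\<lambda>n. bregman R z (x (Suc n) \<omega>))"
      using conv Q(2) by (intro AE_ball_countable'[OF _ Q(1)]) auto
    then show ?thesis using conv[OF x0] AE_space
    proof eventually_elim
      case (elim \<omega>)
      have xs: "x (Suc n) \<omega> \<in> X" for n using xX elim(3) by simp
      obtain p r where p: "p \<in> opt_set f X" and r: "filterlim r at_top sequentially"
          "(\<lambda>k. x (Suc (r k)) \<omega>) \<longlonglongrightarrow> p"
        by (rule optimal_cluster_point[OF X_compact fX, of "\<lambda>n. x (Suc n) \<omega>" a])
           (use xs a_pos not_summable elim(2) in \<open>auto simp: u_def\<close>)
      have "(\<lambda>n. x (Suc n) \<omega>) \<longlonglongrightarrow> p"
        by (rule bregman_convergence[where Q = Q and r = r])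
           (use xs Q p r elim(1) in \<open>auto simp: opt_set_def\<close>)
      from LIMSEQ_imp_Suc[OF this] show ?case using p by blast
    qed
  qed
  define xl where "xl = (\<lambda>\<omega>. lim (\<lambda>n. x (Suc n) \<omega>))"
  \<comment> \<open>The limit may fail to exist, or to be optimal, on a null set; there any fixed minimizer serves.\<close>
  define xs where "xs = (\<lambda>\<omega>. if xl \<omega> \<in> opt_set f X then xl \<omega> else x0)"
  have xl: "xl \<in> borel_measurable M" unfolding xl_def by (rule borel_measurable_lim_metric) (simp add: xM)
  have "xs \<in> borel_measurable M"
    unfolding xs_def
    by (rule measurable_If[OF xl])
       (use measurable_sets[OF xl borel_closed[OF closed_opt_set[OF X_compact fX]]] in
         \<open>auto simp: vimage_def Int_def conj_commute\<close>)
  moreover have "\<forall>\<omega>\<in>space M. xs \<omega> \<in> opt_set f X" using x0 by (simp add: xs_def)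
  moreover have "AE \<omega> in M. (\<lambda>t. x t \<omega>) \<longlonglongrightarrow> xs \<omega>"
    using limit
  proof eventually_elim
    case (elim \<omega>)
    then obtain p where p: "p \<in> opt_set f X" "(\<lambda>t. x t \<omega>) \<longlonglongrightarrow> p" by blast
    then have "xl \<omega> = p" unfolding xl_def by (intro limI LIMSEQ_Suc)
    then show ?case using p by (simp add: xs_def)
  qed
  ultimately show ?thesis by blast
qed

end
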